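(* There exists an absolute constant $c>0$ such that for every power of two $n\ge 4$ there exists a connected graph $G$ on $n$ vertices with pathwidth two such that $\delta(\mathcal{A}(G))\ge c\, n\log n$.
   Context: For a connected graph $G=(V,E)$, a search tree on $G$ is a rooted tree with vertex set $V$ defined recursively: its root is some vertex $r\in V$, and $r$ is joined to the roots of search trees on each connected component of $G-r$. The tubes of a search tree are the vertex sets of its subtrees. Two search trees on $G$ are related by a rotation if their sets of tubes have symmetric difference of size exactly two. The graph associahedron $\mathcal{A}(G)$ is a polytope whose skeleton is isomorphic to the graph on search trees of $G$ with adjacency given by rotations; $\delta(\mathcal{A}(G))$ is the diameter of this graph. Pathwidth is the usual graph parameter. *)

theory Defs
  imports Complex_Main "HOL-Library.FSet" "Graph_Theory.Graph_Theory"
begin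

text \<open>
  Finite simple graphs are the symmetric, loop-free digraphs without parallel arcs of
  \<^locale>\<open>graph\<close> and \<^locale>\<open>pair_graph\<close>. On these, strong connectivity is connectivity, so
  \<^const>\<open>pre_digraph.sccs\<close> is the set of connected components, as induced subgraphs.
\<close>

datatype (rverts: 'a) rtree = Node (root: 'a) (children: "'a rtree fset")

primrec subtrees :: "'a rtree \<Rightarrow> 'a rtree set" where
  "subtrees (Node r ts) = insert (Node r ts) (\<Union> (fset (subtrees |`| ts)))"

text \<open>The bijection \<open>H\<close> assigns to each child subtree of the root the component it searches.\<close>

inductive search_tree :: "('a, 'b) pre_digraph \<Rightarrow> 'a rtree \<Rightarrow> bool" where
  "r \<in> verts G \<Longrightarrow>
   bij_betw H (fset ts) (pre_digraph.sccs (pre_digraph.del_vert G r)) \<Longrightarrow>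
   (\<And>t. t \<in> fset ts \<Longrightarrow> search_tree (H t) t) \<Longrightarrow>
   search_tree G (Node r ts)"

definition tubes :: "'a rtree \<Rightarrow> 'a set set" where
  "tubes T = rverts ` subtrees T"

definition rotation :: "'a rtree \<Rightarrow> 'a rtree \<Rightarrow> bool" where
  "rotation S T \<longleftrightarrow> card ((tubes S - tubes T) \<union> (tubes T - tubes S)) = 2"

definition rotation_graph :: "('a, 'b) pre_digraph \<Rightarrow> 'a rtree pair_pre_digraph" where
  "rotation_graph G =
    \<lparr> pverts = {T. search_tree G T},
      parcs = {(S, T). search_tree G S \<and> search_tree G T \<and> rotation S T} \<rparr>"

lemma pair_wf_digraph_rotation_graph: "pair_wf_digraph (rotation_graph G)"
  by unfold_locales (auto simp: rotation_graph_def)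

text \<open>Two vertices that no walk joins are at distance \<open>\<infinity>\<close>.\<close>

definition graph_diameter :: "('a, 'b) pre_digraph \<Rightarrow> ereal" where
  "graph_diameter G = (SUP u\<in>verts G. SUP v\<in>verts G. wf_digraph.\<mu> G (\<lambda>_. 1) u v)"

text \<open>
  The skeleton of the graph associahedron of \<open>G\<close> is represented by the isomorphic
  \<^term>\<open>rotation_graph G\<close>.
\<close>

definition associahedron_diameter :: "('a, 'b) pre_digraph \<Rightarrow> ereal" where
  "associahedron_diameter G = graph_diameter (with_proj (rotation_graph G))"

definition path_decomposition :: "('a, 'b) pre_digraph \<Rightarrow> 'a set list \<Rightarrow> bool" where
  "path_decomposition G Bs \<longleftrightarrow>
     Bs \<noteq> [] \<and>
     \<Union> (set Bs) = verts G \<and>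
     (\<forall>(u, v) \<in> arcs_ends G. \<exists>B \<in> set Bs. u \<in> B \<and> v \<in> B) \<and>
     (\<forall>i j k. i \<le> j \<and> j \<le> k \<and> k < length Bs \<longrightarrow> Bs ! i \<inter> Bs ! k \<subseteq> Bs ! j)"

text \<open>The subtraction truncates only for the graph without vertices.\<close>

definition decomposition_width :: "'a set list \<Rightarrow> nat" where
  "decomposition_width Bs = Max (card ` set Bs) - 1"

definition pathwidth :: "('a, 'b) pre_digraph \<Rightarrow> nat" where
  "pathwidth G = (LEAST w. \<exists>Bs. path_decomposition G Bs \<and> decomposition_width Bs = w)"

end

theory Submission
  imports Defs
begin

text \<open>
  Take a path of even vertices and put an odd vertex on each edge to form a triangle. Odd
  vertices never separate a connected set, and an even vertex separates only vertices to its left from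
  vertices to its right. Every rotation swaps one pair of vertices, and for exactly one dyadic block
  the pair lies in the block but not in one of its halves; call this a cross swap of the block. In
  the start tree the odd vertices form a chain in bit-reversed order, so those of each block alternate
  between its halves. In the final tree they form a decreasing chain. Undoing the alternation takes
  linearly many cross swaps of every block, because it cannot be avoided by separating the two halves
  with an even vertex: bringing one above the odd vertices costs cross swaps as well. Summing over
  all blocks on the \<open>log n\<close> levels gives the bound.
\<close>

subsection \<open>Tube families and rotations\<close>

text \<open>For a path alone the diameter is linear in n. The odd vertices supply what the path
  lacks: since they separate nothing, they can head a search tree as a chain in any order, so trees
  encode permutations of n/2 elements. Counting inversions still fails, because one even vertex
  raised between the halves of a block makes many odd vertices incomparable at once. Hence a
  charging scheme. The odd vertices of a block are paired, one from each half. A pair touched by a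
  cross swap is charged to that swap, which touches at most two pairs; each untouched pair is
  charged to a cross swap of two even vertices, different ones for different pairs. So a block has
  at most three times as many pairs as cross swaps. At level \<open>e\<close> there are
  \<open>2 ^ (k - Suc e)\<close> blocks with \<open>2 ^ (e - 1)\<close> pairs each, so every level
  weighs \<open>2 ^ (k - 2)\<close>, a quarter of n. Trees are handled only through their tubes. A
  rotation exchanges one tube, and all that is needed about it is how the ancestor relation
  changes.\<close>

text \<open>
  The tubes of a search tree on \<open>X\<close>, for an abstract notion of connected set: \<open>\<K>\<close> are the components
  of \<open>X - {r}\<close>, and \<open>F K\<close> is the family of the subtree on \<open>K\<close>.
\<close>

inductive tube_family :: "('a set \<Rightarrow> bool) \<Rightarrow> 'a set \<Rightarrow> 'a set set \<Rightarrow> bool" for con where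
  "r \<in> X \<Longrightarrow> con X \<Longrightarrow> \<Union>\<K> = X - {r} \<Longrightarrow> disjoint \<K> \<Longrightarrow>
   (\<And>K C. K \<in> \<K> \<Longrightarrow> con C \<Longrightarrow> C \<subseteq> X - {r} \<Longrightarrow> C \<inter> K \<noteq> {} \<Longrightarrow> C \<subseteq> K) \<Longrightarrow>
   (\<And>K. K \<in> \<K> \<Longrightarrow> tube_family con K (F K)) \<Longrightarrow>
   tube_family con X (insert X (\<Union>K\<in>\<K>. F K))"

text \<open>
  In a tube family, this is the tube rooted at \<open>x\<close>; so \<open>y \<in> least_tube F x\<close> means that \<open>x\<close> is
  an ancestor of \<open>y\<close> or \<open>y\<close> itself.
\<close>

definition least_tube :: "'a set set \<Rightarrow> 'a \<Rightarrow> 'a set" where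
  "least_tube F x = \<Inter> {Z \<in> F. x \<in> Z}"

lemma least_tube_trans: "y \<in> least_tube F x \<Longrightarrow> z \<in> least_tube F y \<Longrightarrow> z \<in> least_tube F x"
  by (auto simp: least_tube_def)

lemma mem_least_tube: "x \<in> least_tube F x"
  by (simp add: least_tube_def)

lemma least_tube_subset: "Z \<in> F \<Longrightarrow> x \<in> Z \<Longrightarrow> least_tube F x \<subseteq> Z"
  by (auto simp: least_tube_def)

text \<open>In tree terms, \<open>v\<close> is the parent of the root of \<open>Z\<close>. The last
  clause expresses that \<open>Z\<close> is a whole component of what remains below
  \<open>v\<close>, without speaking of components.\<close>

definition parent_tube :: "('a set \<Rightarrow> bool) \<Rightarrow> 'a set set \<Rightarrow> 'a set \<Rightarrow> 'a \<Rightarrow> bool" where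
  "parent_tube con F Z v \<longleftrightarrow> Z \<subset> least_tube F v \<and> v \<notin> Z \<and>
     (\<forall>Z'\<in>F. Z \<subset> Z' \<longrightarrow> least_tube F v \<subseteq> Z') \<and>
     (\<forall>C. con C \<longrightarrow> C \<subseteq> least_tube F v - {v} \<longrightarrow> C \<inter> Z \<noteq> {} \<longrightarrow> C \<subseteq> Z)"

text \<open>Tubes correspond bijectively to their roots. The root \<open>r\<close> owns
  \<open>X\<close>, as no tube of a component contains \<open>r\<close>. A vertex of a component
  \<open>K\<close> lies in no tube of another component, so its least tube is already determined by
  \<open>F K\<close>; the same locality transfers parents.\<close>

lemma tube_family_props:
  assumes "tube_family con X F"
  shows "X \<in> F \<and> (\<forall>Z\<in>F. Z \<subseteq> X \<and> con Z) \<and> least_tube F ` X = F \<and> inj_on (least_tube F) X \<and>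
    (\<forall>Z\<in>F. Z \<noteq> X \<longrightarrow> (\<exists>v\<in>X. parent_tube con F Z v))"
  using assms
proof induction
  case (1 r X \<K> F)
  let ?F = "insert X (\<Union>K\<in>\<K>. F K)"
  have IH: "K \<in> F K" "\<And>Z. Z \<in> F K \<Longrightarrow> Z \<subseteq> K" "\<And>Z. Z \<in> F K \<Longrightarrow> con Z"
    "least_tube (F K) ` K = F K" "inj_on (least_tube (F K)) K"
    "\<And>Z. Z \<in> F K \<Longrightarrow> Z \<noteq> K \<Longrightarrow> \<exists>v\<in>K. parent_tube con (F K) Z v"
    if "K \<in> \<K>" for K using 1(7)[OF that] by auto
  have sub: "K \<subseteq> X - {r}" if "K \<in> \<K>" for K using 1(3) that by blast
  have disj: "K = K'" if "K \<in> \<K>" "K' \<in> \<K>" "x \<in> K" "x \<in> K'" for K K' x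
    using \<open>disjoint \<K>\<close> that unfolding disjoint_def by blast
  have in_K: "Z \<in> F K" if "K \<in> \<K>" "Z \<in> ?F" "Z \<noteq> X" "x \<in> Z" "x \<in> K" for K Z x
    using that disj IH(2) by (smt (verit) UN_E insert_iff subsetD)
  have lt_r: "least_tube ?F r = X"
    using sub IH(2) \<open>r \<in> X\<close> by (fastforce simp: least_tube_def)
  have lt_K: "least_tube ?F x = least_tube (F K) x" if "K \<in> \<K>" "x \<in> K" for K x
  proof -
    have "x \<in> X" using sub that by blast
    then have "{Z \<in> ?F. x \<in> Z} = insert X {Z \<in> F K. x \<in> Z}"
      using in_K[OF that(1) _ _ _ that(2)] that(1) by blast
    moreover have "least_tube (F K) x \<subseteq> X"
      using least_tube_subset[OF IH(1)] that sub by blast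
    ultimately show ?thesis by (auto simp: least_tube_def)
  qed
  have X: "X = insert r (\<Union>\<K>)" using 1 by auto
  have img: "least_tube ?F ` X = ?F"
  proof -
    have "least_tube ?F ` \<Union>\<K> = (\<Union>K\<in>\<K>. least_tube (F K) ` K)"
      using lt_K by (auto simp: image_iff) (metis UnionI)
    also have "\<dots> = (\<Union>K\<in>\<K>. F K)" using IH(4) by auto
    finally have "least_tube ?F ` insert r (\<Union>\<K>) = ?F" unfolding image_insert lt_r by (rule arg_cong)
    then show ?thesis using X by metis
  qed
  have inj: "inj_on (least_tube ?F) X"
  proof (rule inj_onI)
    fix x y assume xy: "x \<in> X" "y \<in> X" "least_tube ?F x = least_tube ?F y"
    have m: "x \<in> least_tube ?F y" "y \<in> least_tube ?F x"
      using mem_least_tube[of x ?F] mem_least_tube[of y ?F] xy by auto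
    have in_lt: "y \<in> K" if "K \<in> \<K>" "x \<in> K" "y \<in> least_tube ?F x" for K x y
      using lt_K[OF that(1,2)] least_tube_subset[OF IH(1)[OF that(1)] that(2)] that(3) by auto
    show "x = y"
    proof (cases "x = r \<or> y = r")
      case True
      have "r \<notin> least_tube ?F z" if z: "z \<in> X" "z \<noteq> r" for z
      proof
        assume "r \<in> least_tube ?F z"
        moreover obtain K where "K \<in> \<K>" "z \<in> K" using z X by auto
        ultimately show False using in_lt sub by blast
      qed
      then show ?thesis using True m xy by metis
    next
      case False
      then obtain K where K: "K \<in> \<K>" "x \<in> K" using xy X by auto
      then have "y \<in> K" using in_lt[OF K m(2)] by simp
      then have "least_tube (F K) x = least_tube (F K) y" using lt_K[OF K(1)] K xy(3) by simp
      then show ?thesis using inj_onD[OF IH(5)[OF K(1)]] K \<open>y \<in> K\<close> by blast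
    qed
  qed
  have par: "\<exists>v\<in>X. parent_tube con ?F Z v" if Z: "Z \<in> ?F" "Z \<noteq> X" for Z
  proof -
    obtain K where K: "K \<in> \<K>" "Z \<in> F K" using Z by auto
    show ?thesis
    proof (cases "Z = {}")
      case False
      then obtain z where z: "z \<in> Z" by auto
      have zK: "z \<in> K" using IH(2) K z by auto
      show ?thesis
      proof (cases "Z = K")
        case True
        have "least_tube ?F r \<subseteq> Z'" if "Z' \<in> ?F" "Z \<subset> Z'" for Z'
        proof (cases "Z' = X")
          case False
          then have "Z' \<in> F K" using in_K[OF K(1) that(1) False _ zK] z that(2) by auto
          then show ?thesis using IH(2)[OF K(1)] that True by blast
        qed (simp add: lt_r)
        then have "parent_tube con ?F Z r"
          unfolding parent_tube_def lt_r using sub[OF K(1)] True 1(5)[OF K(1)] \<open>r \<in> X\<close> by auto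
        then show ?thesis using \<open>r \<in> X\<close> by auto
      next
        case False
        obtain v where v: "v \<in> K" "parent_tube con (F K) Z v" using IH(6)[OF K False] by auto
        have lt: "least_tube ?F v = least_tube (F K) v" using lt_K K v by auto
        have "least_tube (F K) v \<subseteq> Z'" if "Z' \<in> ?F" "Z \<subset> Z'" for Z'
        proof (cases "Z' = X")
          case True
          then show ?thesis using least_tube_subset[OF IH(1)[OF K(1)] v(1)] sub[OF K(1)] by auto
        next
          case False
          then have "Z' \<in> F K" using in_K[OF K(1) that(1) False _ zK] z that(2) by auto
          then show ?thesis using v(2) that unfolding parent_tube_def by auto
        qed
        then have "parent_tube con ?F Z v" using v(2) unfolding parent_tube_def lt by (intro conjI) simp_all
        then show ?thesis using v(1) sub K by auto
      qed
    next
      case True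
      then have "Z \<notin> least_tube (F K) ` K" using mem_least_tube by fast
      then show ?thesis using IH(4) K by auto
    qed
  qed
  have tube: "Z \<subseteq> X \<and> con Z" if "Z \<in> ?F" for Z
    using that IH(2,3) sub \<open>con X\<close> by blast
  show ?case
  proof (intro conjI ballI impI)
    show "X \<in> ?F" by simp
    show "Z \<subseteq> X" "con Z" if "Z \<in> ?F" for Z using tube[OF that] by auto
    show "\<exists>v\<in>X. parent_tube con ?F Z v" if "Z \<in> ?F" "Z \<noteq> X" for Z by (rule par[OF that])
  qed (fact img inj)+
qed

definition swapped :: "'a set set \<Rightarrow> 'a set set \<Rightarrow> 'a \<Rightarrow> 'a \<Rightarrow> bool" where
  "swapped S T u v \<longleftrightarrow> v \<in> least_tube S u \<and> u \<notin> least_tube S v \<and> u \<in> least_tube T v \<and> v \<notin> least_tube T u"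

lemma swapped_commute: "swapped S T u v \<longleftrightarrow> swapped T S v u"
  by (auto simp: swapped_def)

text \<open>Both families have as many tubes as \<open>X\<close> has vertices, so a symmetric
  difference of size two splits evenly.\<close>

lemma tube_families_rotation:
  assumes "finite X" "tube_family con X S" "tube_family con X T" "card ((S - T) \<union> (T - S)) = 2"
  obtains A B where "S - T = {A}" "T - S = {B}"
proof -
  have cX: "card F = card X" and fF: "finite F" if "tube_family con X F" for F
    using tube_family_props[OF that] card_image[of "least_tube F" X] \<open>finite X\<close> finite_imageI by metis+
  have fin: "finite S" "finite T" using fF assms by auto
  have "card (S - T) = card (T - S)"
    using card_Diff_subset_Int[of S T] card_Diff_subset_Int[of T S] fin cX assms(2,3)
    by (simp add: Int_commute)
  moreover have "card ((S - T) \<union> (T - S)) = card (S - T) + card (T - S)"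
    using fin by (intro card_Un_disjoint) auto
  ultimately have "card (S - T) = 1" "card (T - S) = 1" using assms(4) by auto
  then show ?thesis using that by (auto simp: card_1_singleton_iff)
qed

text \<open>If the \<open>T\<close>-tube of \<open>x\<close> belonged to \<open>S\<close> as well,
  it would contain the least \<open>S\<close>-tube of \<open>x\<close>; so it must be the new
  one.\<close>

lemma least_tube_mono_diff:
  assumes S: "tube_family con X S" and T: "tube_family con X T" and B: "T - S \<subseteq> {B}"
    and "x \<in> X" "\<not> least_tube S x \<subseteq> least_tube T x"
  shows "least_tube T x = B"
  using least_tube_subset[of "least_tube T x" S x] tube_family_props[OF T] mem_least_tube[of x T] assms
  by blast

text \<open>In a swap, the new tube \<open>B\<close> is rooted at \<open>u\<close> and the lost tube
  \<open>A\<close> was rooted at \<open>v\<close>. As a tube determines its root, \<open>A\<close>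
  and \<open>B\<close> determine the pair.\<close>

lemma swapped_unique:
  assumes S: "tube_family con X S" and T: "tube_family con X T" and "S - T = {A}" "T - S = {B}"
    and "u \<in> X" "v \<in> X" "swapped S T u v" "u' \<in> X" "v' \<in> X" "swapped S T u' v'"
  shows "u = u' \<and> v = v'"
proof -
  have "least_tube T u = B \<and> least_tube S v = A" if "u \<in> X" "v \<in> X" "swapped S T u v" for u v
    using that least_tube_mono_diff[OF S T, of B u] least_tube_mono_diff[OF T S, of A v] assms(3,4)
    unfolding swapped_def by blast
  then have "least_tube T u = least_tube T u'" "least_tube S v = least_tube S v'" using assms by metis+
  then show ?thesis using tube_family_props[OF S] tube_family_props[OF T] assms by (metis inj_onD)
qed

text \<open>
  A rotation that ends an ancestor relation \<open>x\<close> over \<open>y\<close> moves some \<open>v\<close> over \<open>x\<close>, and either \<open>v\<close> is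
  \<open>y\<close> or \<open>v\<close> now separates \<open>x\<close> from \<open>y\<close>. Exchanging \<open>S\<close> and \<open>T\<close> describes the relations gained.
\<close>

lemma least_tube_lost:
  assumes S: "tube_family con X S" and T: "tube_family con X T" and A: "S - T = {A}" and B: "T - S = {B}"
    and xy: "x \<in> X" "y \<in> least_tube S x" "y \<notin> least_tube T x"
  obtains v where "v \<in> X" "swapped S T x v" "y \<in> least_tube T v" "con (least_tube T v)"
    "y = v \<or> \<not> (\<exists>C. con C \<and> C \<subseteq> least_tube T v - {v} \<and> x \<in> C \<and> y \<in> C)"
proof -
  note pS = tube_family_props[OF S] and pT = tube_family_props[OF T]
  have DS: "least_tube S w \<in> S" if "w \<in> X" for w using pS that by blast
  have DT: "least_tube T w \<in> T" if "w \<in> X" for w using pT that by blast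
  have xB: "least_tube T x = B" using least_tube_mono_diff[OF S T _ xy(1), of B] B xy by auto
  have "B \<in> T" "B \<noteq> X" using B pS by auto
  then obtain v where v: "v \<in> X" "parent_tube con T B v" using pT by blast
  let ?C = "least_tube T v"
  have vC: "B \<subset> ?C" "v \<notin> B" "\<And>Z. Z \<in> T \<Longrightarrow> B \<subset> Z \<Longrightarrow> ?C \<subseteq> Z"
    "\<And>K. con K \<Longrightarrow> K \<subseteq> ?C - {v} \<Longrightarrow> K \<inter> B \<noteq> {} \<Longrightarrow> K \<subseteq> B"
    using v(2) unfolding parent_tube_def by auto
  have x: "x \<in> B" "x \<in> ?C" using xB mem_least_tube vC by fast+
  have "?C \<noteq> B" using vC by auto
  then have CS: "?C \<in> S" using B DT v by blast
  have sub: "least_tube S x \<subseteq> ?C" using least_tube_subset[OF CS x(2)] .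
  have yB: "y \<notin> B" using xy xB by simp
  \<comment> \<open>The tube of \<open>v\<close> in \<open>T\<close> was the tube of
    \<open>x\<close> in \<open>S\<close>. Otherwise the tube of \<open>x\<close> in \<open>S\<close>
    is the lost \<open>A\<close>, a connected set that avoids \<open>v\<close> and meets
    \<open>B\<close>; it then lies inside \<open>B\<close>, which contradicts that it contains
    \<open>y\<close>.\<close>
  have "least_tube S x = ?C"
  proof (cases "least_tube S x \<in> T")
    case True
    then have "B \<subset> least_tube S x"
      using least_tube_subset[OF True mem_least_tube] xB xy(2) yB by blast
    then show ?thesis using vC(3)[OF True] sub by auto
  next
    case False
    then have xA: "least_tube S x = A" using A DS xy by blast
    \<comment> \<open>\<open>A\<close> is rooted at \<open>x\<close>, so \<open>v\<close> in
      \<open>A\<close> would root a smaller tube of \<open>S\<close>, which survives in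
      \<open>T\<close> and contains \<open>?C\<close>. As \<open>?C\<close> contains
      \<open>A\<close>, this would make the lost tube \<open>A\<close> a tube of
      \<open>T\<close>.\<close>
    have nv: "v \<notin> A"
    proof
      assume "v \<in> A"
      have "v \<noteq> x" using x vC by auto
      then have "least_tube S v \<noteq> A" using xA pS v xy(1) by (metis inj_onD)
      then have "least_tube S v \<in> T" using DS A v by blast
      then have "?C \<subseteq> least_tube S v" using least_tube_subset mem_least_tube by metis
      moreover have "least_tube S v \<subseteq> A" using least_tube_subset[OF _ \<open>v \<in> A\<close>] A by auto
      ultimately have "?C = A" using sub xA by auto
      then show False using A DT v by blast
    qed
    have "con A" "A \<in> S" using A pS by auto
    then have "A \<subseteq> B" using vC(4)[of A] nv sub xA x(1) mem_least_tube[of x S] by auto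
    then show ?thesis using xy xA yB by auto
  qed
  moreover have "x \<notin> least_tube S v"
  proof
    assume "x \<in> least_tube S v"
    then have "least_tube S v = ?C"
      using least_tube_subset[OF DS[OF v(1)]] least_tube_subset[OF CS mem_least_tube] \<open>least_tube S x = ?C\<close>
      by blast
    then have "v = x" using \<open>least_tube S x = ?C\<close> pS v xy(1) by (metis inj_onD)
    then show False using x vC by auto
  qed
  ultimately have "swapped S T x v"
    using x xB vC mem_least_tube[of v T] unfolding swapped_def by auto
  moreover have "y \<in> ?C" using xy sub by auto
  moreover have "con ?C" using DT v pT by blast
  moreover have "y = v \<or> \<not> (\<exists>C. con C \<and> C \<subseteq> ?C - {v} \<and> x \<in> C \<and> y \<in> C)"
    using vC(4) x yB by blast
  ultimately show ?thesis using that v by blast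
qed

subsection \<open>Search trees\<close>

lemma induced_subgraph_trans:
  "induced_subgraph H K \<Longrightarrow> induced_subgraph K G \<Longrightarrow> induced_subgraph H G"
  unfolding induced_subgraph_def subgraph_def compatible_def by (safe; simp; blast)

lemma induce_subgraph_induced_subgraph:
  assumes "induced_subgraph H G" "X \<subseteq> verts H"
  shows "H \<restriction> X = G \<restriction> X"
proof -
  have "tail H = tail G" "head H = head G"
    "arcs H = {e \<in> arcs G. tail G e \<in> verts H \<and> head G e \<in> verts H}"
    using assms(1) by (simp_all add: induced_subgraph_def subgraph_def compatible_def)
  then show ?thesis using assms(2) unfolding induce_subgraph_def by auto
qed

lemma (in wf_digraph) induced_subgraph_del_vert: "induced_subgraph (del_vert u) G"
  using subgraph_del_vert[of u] wellformed
  unfolding induced_subgraph_def del_vert_simps by blast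

lemma (in wf_digraph) Union_verts_sccs: "\<Union> (verts ` sccs) = verts G"
proof
  show "verts G \<subseteq> \<Union> (verts ` sccs)"
    using scc_of_in_sccs_verts in_scc_of_self unfolding sccs_verts_conv by blast
qed (use in_sccs_imp_induced in \<open>auto simp: induced_subgraph_def subgraph_def\<close>)

lemma rverts_search_tree: "search_tree G t \<Longrightarrow> wf_digraph G \<Longrightarrow> rverts t = verts G"
proof (induction rule: search_tree.induct)
  case (1 r G H ts)
  interpret G: wf_digraph G by fact
  interpret D: wf_digraph "G.del_vert r" by (rule G.wf_digraph_del_vert)
  have H: "H ` fset ts = D.sccs" using 1 by (simp add: bij_betw_def)
  have "rverts t = verts (H t)" if "t \<in> fset ts" for t
  proof -
    have "H t \<in> D.sccs" using H that by blast
    then show ?thesis using 1(4)[OF that] wf_digraphI_induced[OF D.in_sccs_imp_induced] by simp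
  qed
  then have "rverts (Node r ts) = insert r (\<Union> (verts ` H ` fset ts))" by auto
  also have "\<dots> = verts G" unfolding H D.Union_verts_sccs using 1 by (auto simp: G.del_vert_simps)
  finally show ?case .
qed

lemma tubes_Node: "tubes (Node r ts) = insert (rverts (Node r ts)) (\<Union>t\<in>fset ts. tubes t)"
  by (auto simp: tubes_def)

text \<open>\<open>tube_family\<close> needs one notion of connectivity throughout the recursion.
  Hence it is measured in the ambient \<open>G\<close>, while \<open>H\<close> runs through induced
  subgraphs.\<close>

lemma tube_family_search_tree:
  assumes "search_tree H t" "wf_digraph G" "induced_subgraph H G" "strongly_connected H"
  shows "tube_family (\<lambda>Z. strongly_connected (G \<restriction> Z)) (verts H) (tubes t)"
  using assms
proof (induction rule: search_tree.induct)
  case (1 r H Hf ts)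
  let ?con = "\<lambda>Z. strongly_connected (G \<restriction> Z)"
  interpret G: wf_digraph G by fact
  interpret H: wf_digraph H using 1 by (blast intro: wf_digraphI_induced)
  interpret D: wf_digraph "H.del_vert r" by (rule H.wf_digraph_del_vert)
  let ?D = "H.del_vert r" and ?\<K> = "verts ` D.sccs"
  have indD: "induced_subgraph ?D G"
    using induced_subgraph_trans[OF H.induced_subgraph_del_vert] 1 by blast
  have bij: "bij_betw (verts \<circ> Hf) (fset ts) ?\<K>"
    using 1(2) D.inj_on_verts_sccs by (intro bij_betw_trans) (auto simp: inj_on_imp_bij_betw)
  \<comment> \<open>\<open>Hf\<close> maps child trees to components, whereas
    \<open>tube_family\<close> wants a family for each component; \<open>g\<close> inverts the
    assignment.\<close>
  define g where "g = inv_into (fset ts) (verts \<circ> Hf)"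
  have g: "g K \<in> fset ts" "verts (Hf (g K)) = K" if "K \<in> ?\<K>" for K
    using bij_betw_inv_into_right[OF bij that] bij_betw_apply[OF bij_betw_inv_into[OF bij] that]
    by (auto simp: g_def)
  have gts: "g ` ?\<K> = fset ts"
    using bij_betw_inv_into[OF bij] unfolding g_def by (simp add: bij_betw_def)
  have "tube_family ?con (verts H) (insert (verts H) (\<Union>K\<in>?\<K>. tubes (g K)))"
  proof (rule tube_family.intros[where r = r])
    show "?con (verts H)" using 1 G.induce_eq_iff_induced by metis
    show "\<Union> ?\<K> = verts H - {r}" unfolding D.Union_verts_sccs by (simp add: H.del_vert_simps)
    show "disjoint ?\<K>"
      using D.sccs_verts_disjoint by (auto simp: disjoint_def D.sccs_verts_conv[symmetric])
    show "C \<subseteq> K" if "K \<in> ?\<K>" "?con C" "C \<subseteq> verts H - {r}" "C \<inter> K \<noteq> {}" for K C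
    proof
      fix x assume "x \<in> C"
      obtain y where y: "y \<in> C" "y \<in> K" using \<open>C \<inter> K \<noteq> {}\<close> by blast
      have C: "C \<subseteq> verts ?D" using that by (simp add: H.del_vert_simps)
      have "G \<restriction> C = ?D \<restriction> C"
        using induce_subgraph_induced_subgraph[OF indD C] by simp
      then have "x \<rightarrow>\<^sup>*\<^bsub>?D\<^esub> y" "y \<rightarrow>\<^sup>*\<^bsub>?D\<^esub> x"
        using \<open>?con C\<close> \<open>x \<in> C\<close> y D.reachable_induce_subgraphD[OF _ C]
        by (simp_all add: strongly_connected_def)
      moreover have K: "K \<in> D.sccs_verts" using \<open>K \<in> ?\<K>\<close> by (simp add: D.sccs_verts_conv)
      ultimately show "x \<in> K" using y K[unfolded D.in_sccs_verts_conv_reachable] by metis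
    qed
    show "tube_family ?con K (tubes (g K))" if K: "K \<in> ?\<K>" for K
    proof -
      have scc: "Hf (g K) \<in> D.sccs" using bspec[OF bij_betwE[OF 1(2)] g(1)[OF K]] .
      then have "induced_subgraph (Hf (g K)) G"
        using induced_subgraph_trans[OF D.in_sccs_imp_induced indD] by simp
      moreover have "strongly_connected (Hf (g K))" using scc by (simp add: D.sccs_def)
      ultimately show ?thesis using 1(4)[OF g(1)[OF K] \<open>wf_digraph G\<close>] g(2)[OF K] by simp
    qed
  qed fact
  moreover have "rverts (Node r ts) = verts H"
    using rverts_search_tree[OF search_tree.intros[OF 1(1,2,3)] H.wf_digraph_axioms] .
  moreover have "(\<Union>K\<in>?\<K>. tubes (g K)) = (\<Union>t\<in>fset ts. tubes t)" using gts by (metis image_image)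
  ultimately show ?case by (simp only: tubes_Node)
qed

lemma (in wf_digraph) sccs_strongly_connected:
  assumes "strongly_connected G"
  shows "sccs = {G}"
proof -
  have "H = G" if "induced_subgraph H G" "verts H = verts G" for H
    using that induced_subgraph_refl induced_eq_verts_imp_eq by metis
  then show ?thesis
    using assms induced_subgraph_refl by (auto simp: sccs_def induced_subgraph_def subgraph_def)
qed

lemma del_vert_induce_subgraph: "pre_digraph.del_vert (G \<restriction> X) r = G \<restriction> (X - {r})"
  by (auto simp: pre_digraph.del_vert_def induce_subgraph_def)

text \<open>All upper sets of the ranking are connected, so removing the vertex of least rank leaves
  a single component, and the recursion never branches.\<close>

lemma search_tree_chain:
  fixes \<kappa> :: "'a \<Rightarrow> nat"
  assumes "wf_digraph G" "finite X" "X \<noteq> {}" "inj_on \<kappa> X"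
    and "\<And>x. x \<in> X \<Longrightarrow> strongly_connected (G \<restriction> {y \<in> X. \<kappa> x \<le> \<kappa> y})"
  shows "\<exists>t. search_tree (G \<restriction> X) t \<and> tubes t = (\<lambda>x. {y \<in> X. \<kappa> x \<le> \<kappa> y}) ` X"
  using assms(2-)
proof (induction X rule: finite_psubset_induct)
  case (psubset X)
  interpret wf_digraph G by fact
  define r where "r = arg_min_on \<kappa> X"
  have r: "r \<in> X" "\<And>y. y \<in> X \<Longrightarrow> \<kappa> r \<le> \<kappa> y"
    using psubset arg_min_if_finite(1)[of X \<kappa>] arg_min_least[of X _ \<kappa>] by (auto simp: r_def)
  let ?X = "X - {r}"
  have up_r: "{y \<in> X. \<kappa> r \<le> \<kappa> y} = X" using r by auto
  have lt: "\<kappa> r < \<kappa> x" if "x \<in> ?X" for x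
    using that r psubset.prems(2) by (metis DiffD1 DiffD2 inj_onD insertI1 nat_less_le)
  have up: "{y \<in> X. \<kappa> x \<le> \<kappa> y} = {y \<in> ?X. \<kappa> x \<le> \<kappa> y}" if "x \<in> ?X" for x
    using lt[OF that] by auto
  have wf: "wf_digraph (G \<restriction> Z)" for Z by (rule wellformed_induce_subgraph)
  have rv: "rverts t = X" if "search_tree (G \<restriction> X) t" for t
    using rverts_search_tree[OF that] wf by simp
  show ?case
  proof (cases "?X = {}")
    case True
    then have X: "X = {r}" using r by auto
    have "pre_digraph.sccs (G \<restriction> {}) = {}"
      by (auto simp: pre_digraph.sccs_def induced_subgraph_def subgraph_def strongly_connected_def)
    then have "search_tree (G \<restriction> X) (Node r {||})"
      using X by (intro search_tree.intros) (auto simp: del_vert_induce_subgraph bij_betw_def)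
    moreover have "tubes (Node r {||}) = (\<lambda>x. {y \<in> X. \<kappa> x \<le> \<kappa> y}) ` X"
      using X by (auto simp: tubes_Node)
    ultimately show ?thesis by blast
  next
    case False
    have sc: "strongly_connected (G \<restriction> {y \<in> ?X. \<kappa> x \<le> \<kappa> y})" if "x \<in> ?X" for x
      using psubset.prems(3)[of x] up[OF that] that by simp
    obtain t where t: "search_tree (G \<restriction> ?X) t" "tubes t = (\<lambda>x. {y \<in> ?X. \<kappa> x \<le> \<kappa> y}) ` ?X"
      using psubset.IH[of ?X] r False sc inj_on_subset[OF psubset.prems(2), of ?X] by blast
    define s where "s = arg_min_on \<kappa> ?X"
    have s: "s \<in> ?X" "\<And>y. y \<in> ?X \<Longrightarrow> \<kappa> s \<le> \<kappa> y"
      using psubset(1) False arg_min_if_finite(1)[of ?X \<kappa>] arg_min_least[of ?X _ \<kappa>] by (auto simp: s_def)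
    then have "{y \<in> ?X. \<kappa> s \<le> \<kappa> y} = ?X" by auto
    then have "strongly_connected (G \<restriction> ?X)" using sc[OF s(1)] by simp
    then have "pre_digraph.sccs (G \<restriction> ?X) = {G \<restriction> ?X}"
      using wf_digraph.sccs_strongly_connected[OF wf] by blast
    then have st: "search_tree (G \<restriction> X) (Node r {|t|})"
      using r t by (intro search_tree.intros[where H = "\<lambda>_. G \<restriction> ?X"])
        (auto simp: del_vert_induce_subgraph bij_betw_def)
    moreover have "tubes (Node r {|t|}) = (\<lambda>x. {y \<in> X. \<kappa> x \<le> \<kappa> y}) ` X"
    proof -
      have "tubes (Node r {|t|}) = insert X (tubes t)"
        unfolding tubes_Node rv[OF st] by simp
      also have "\<dots> = insert {y \<in> X. \<kappa> r \<le> \<kappa> y} ((\<lambda>x. {y \<in> X. \<kappa> x \<le> \<kappa> y}) ` ?X)"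
        unfolding t(2) up_r by (intro arg_cong2[where f = insert] image_cong refl up[symmetric])
      finally show ?thesis using insert_Diff[OF r(1)] by (metis (no_types, lifting) image_insert)
    qed
    ultimately show ?thesis by blast
  qed
qed

lemma least_tube_chain:
  fixes \<kappa> :: "'a \<Rightarrow> nat"
  assumes "x \<in> X"
  shows "least_tube ((\<lambda>x. {y \<in> X. \<kappa> x \<le> \<kappa> y}) ` X) x = {y \<in> X. \<kappa> x \<le> \<kappa> y}"
  using assms by (auto simp: least_tube_def)

subsection \<open>Triangle strips\<close>

text \<open>The vertex 2i+1 is the tip of the triangle on the edge from 2i to 2i+2. For even
  \<open>n\<close> the last tip has only one neighbour.\<close>

definition triangle_strip :: "nat \<Rightarrow> nat pair_pre_digraph" where
  "triangle_strip n = \<lparr> pverts = {..<n},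
     parcs = {(u, v). u < n \<and> v < n \<and> (v = Suc u \<or> u = Suc v \<or> even u \<and> (v = u + 2 \<or> u = v + 2))} \<rparr>"

abbreviation strip_connected :: "nat \<Rightarrow> nat set \<Rightarrow> bool" where
  "strip_connected n X \<equiv> strongly_connected (with_proj (triangle_strip n) \<restriction> X)"

lemma pverts_triangle_strip [simp]: "pverts (triangle_strip n) = {..<n}"
  by (simp add: triangle_strip_def)

lemma pair_graph_triangle_strip: "pair_graph (triangle_strip n)"
proof -
  have "finite (parcs (triangle_strip n))"
    by (rule finite_subset[of _ "{..<n} \<times> {..<n}"]) (auto simp: triangle_strip_def)
  then show ?thesis
    by unfold_locales (auto simp: triangle_strip_def symmetric_def sym_def)
qed

text \<open>An edge jumps over at most one vertex, and that vertex is odd; so a walk cannot pass a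
  missing even vertex. Conversely, one can always step through the even vertices in between.\<close>

lemma strip_connected_iff:
  assumes X: "X \<subseteq> {..<n}"
  shows "strip_connected n X \<longleftrightarrow> X \<noteq> {} \<and> (\<forall>x\<in>X. \<forall>y\<in>X. \<forall>z. even z \<and> x < z \<and> z < y \<longrightarrow> z \<in> X)"
proof -
  let ?G = "with_proj (triangle_strip n)"
  interpret P: pair_graph "triangle_strip n" by (rule pair_graph_triangle_strip)
  interpret G: wf_digraph "?G \<restriction> X" by (rule P.wellformed_induce_subgraph)
  have arc: "u \<rightarrow>\<^bsub>?G \<restriction> X\<^esub> v \<longleftrightarrow> u \<in> X \<and> v \<in> X \<and>
      (v = Suc u \<or> u = Suc v \<or> even u \<and> (v = u + 2 \<or> u = v + 2))" for u v
    using X by (auto simp: arcs_ends_conv triangle_strip_def image_iff)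
  show ?thesis
  proof (intro iffI conjI ballI allI impI)
    assume c: "strip_connected n X"
    then show "X \<noteq> {}" by (simp add: strongly_connected_def)
    fix x y z assume xyz: "x \<in> X" "y \<in> X" "even z \<and> x < z \<and> z < y"
    show "z \<in> X"
    proof (rule ccontr)
      assume z: "z \<notin> X"
      have "x \<rightarrow>\<^sup>*\<^bsub>?G \<restriction> X\<^esub> y" using c xyz by (simp add: strongly_connected_def)
      then have "y < z"
      proof (induction rule: G.reachable_induct)
        case (step u v)
        then have "v \<noteq> z" "u < z" using z by (auto simp: arc)
        show ?case
        proof (rule ccontr)
          assume "\<not> v < z"
          then have "v > z" using \<open>v \<noteq> z\<close> by simp
          then have "even u" "v = u + 2" "z = Suc u" using step(2) \<open>u < z\<close> unfolding arc by auto
          then show False using xyz by simp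
        qed
      qed (use xyz in simp)
      then show False using xyz by simp
    qed
  next
    assume conv: "X \<noteq> {} \<and> (\<forall>x\<in>X. \<forall>y\<in>X. \<forall>z. even z \<and> x < z \<and> z < y \<longrightarrow> z \<in> X)"
    have adj: "x \<rightarrow>\<^sup>*\<^bsub>?G \<restriction> X\<^esub> y \<and> y \<rightarrow>\<^sup>*\<^bsub>?G \<restriction> X\<^esub> x"
      if "x \<in> X" "y \<in> X" "y = Suc x \<or> even x \<and> y = x + 2" for x y
      using that by (intro conjI G.reachable_adjI) (unfold arc, auto)
    have reach: "x \<rightarrow>\<^sup>*\<^bsub>?G \<restriction> X\<^esub> y \<and> y \<rightarrow>\<^sup>*\<^bsub>?G \<restriction> X\<^esub> x" if "x \<in> X" "y \<in> X" "x < y" for x y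
      using that
    proof (induction "y - x" arbitrary: x rule: less_induct)
      case less
      show ?case
      proof (cases "y = Suc x \<or> even x \<and> y = x + 2")
        case True
        then show ?thesis using adj less.prems by blast
      next
        case False
        \<comment> \<open>The next even vertex after \<open>x\<close>. It is adjacent to
          \<open>x\<close>, and it belongs to \<open>X\<close> because it lies before
          \<open>y\<close>.\<close>
        define w where "w = (if even x then x + 2 else Suc x)"
        have w: "even w" "x < w" "w < y" using False less.prems by (auto simp: w_def)
        then have "w \<in> X" using conv less.prems by blast
        moreover have "w = Suc x \<or> even x \<and> w = x + 2" by (simp add: w_def)
        ultimately show ?thesis
          using adj[of x w] less.hyps[of w] less.prems w G.reachable_trans by (meson diff_less_mono2 less_imp_le_nat)
      qed
    qed
    show "strip_connected n X"
    proof (rule strongly_connectedI)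
      show "u \<rightarrow>\<^sup>*\<^bsub>?G \<restriction> X\<^esub> v" if "u \<in> verts (?G \<restriction> X)" "v \<in> verts (?G \<restriction> X)" for u v
        using reach[of u v] reach[of v u] that by (cases u v rule: linorder_cases) auto
    qed (use conv in simp)
  qed
qed

text \<open>If \<open>v\<close> is odd, \<open>D - {v}\<close> stays connected; if \<open>x\<close>
  and \<open>y\<close> are on the same side of \<open>v\<close>, the part of \<open>D\<close> on
  that side is connected.\<close>

lemma strip_separator:
  assumes "strip_connected n D" "D \<subseteq> {..<n}" "x \<in> D" "y \<in> D" "x \<noteq> v" "y \<noteq> v"
    and sep: "\<not> (\<exists>C. strip_connected n C \<and> C \<subseteq> D - {v} \<and> x \<in> C \<and> y \<in> C)"
  shows "even v \<and> (x < v \<and> v < y \<or> y < v \<and> v < x)"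
proof (rule ccontr)
  assume n: "\<not> ?thesis"
  have D: "\<forall>x\<in>D. \<forall>y\<in>D. \<forall>z. even z \<and> x < z \<and> z < y \<longrightarrow> z \<in> D"
    using iffD1[OF strip_connected_iff[OF assms(2)] assms(1)] by (rule conjunct2)
  define C where "C = (if odd v then D - {v} else if x < v then D \<inter> {..<v} else D \<inter> {v<..})"
  have C: "C \<subseteq> D - {v}" "x \<in> C" "y \<in> C" using assms(3-6) n by (auto simp: C_def)
  then have "C \<subseteq> {..<n}" using assms(2) by blast
  have "c \<in> C" if "a \<in> C" "b \<in> C" "even c \<and> a < c \<and> c < b" for a b c
  proof -
    have "a \<in> D" "b \<in> D" using that C(1) by blast+
    then have "c \<in> D" using D that(3) by blast
    then show ?thesis using that unfolding C_def by (auto split: if_splits)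
  qed
  then have "strip_connected n C" using C(2) unfolding strip_connected_iff[OF \<open>C \<subseteq> {..<n}\<close>] by blast
  then show False using sep C by blast
qed

lemma strip_strongly_connected:
  assumes "n > 0"
  shows "strongly_connected (with_proj (triangle_strip n))"
proof -
  interpret P: pair_graph "triangle_strip n" by (rule pair_graph_triangle_strip)
  have "strip_connected n {..<n}" using assms by (subst strip_connected_iff) auto
  moreover have "with_proj (triangle_strip n) \<restriction> {..<n} = with_proj (triangle_strip n)"
    by (auto simp: induce_subgraph_def with_proj_def triangle_strip_def)
  ultimately show ?thesis by simp
qed

lemma connected_triangle_strip:
  assumes "n > 0"
  shows "Digraph_Component.connected (with_proj (triangle_strip n))"
proof -
  have "mk_symmetric (with_proj (triangle_strip n)) = triangle_strip n"
    by (auto simp: mk_symmetric_def triangle_strip_def)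
  then show ?thesis using strip_strongly_connected[OF assms] by (simp add: connected_def)
qed

section \<open>Pathwidth of triangle strips\<close>

lemma triangle_subset_bag:
  assumes "path_decomposition G Bs" "{(a, b), (b, c), (a, c)} \<subseteq> arcs_ends G"
  shows "\<exists>B\<in>set Bs. {a, b, c} \<subseteq> B"
proof -
  have conv: "x \<in> Bs ! j" if "i \<le> j" "j \<le> k" "k < length Bs" "x \<in> Bs ! i" "x \<in> Bs ! k" for i j k x
    using assms that unfolding path_decomposition_def by blast
  have "\<exists>i<length Bs. u \<in> Bs ! i \<and> v \<in> Bs ! i" if "(u, v) \<in> arcs_ends G" for u v
  proof -
    have "\<exists>B\<in>set Bs. u \<in> B \<and> v \<in> B"
      using assms(1) that unfolding path_decomposition_def by (elim conjE) (drule (1) bspec, simp)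
    then show ?thesis by (auto simp: in_set_conv_nth)
  qed
  then obtain i j k where *: "i < length Bs" "a \<in> Bs ! i" "b \<in> Bs ! i" "j < length Bs" "b \<in> Bs ! j" "c \<in> Bs ! j"
    "k < length Bs" "a \<in> Bs ! k" "c \<in> Bs ! k"
    using assms(2) unfolding insert_subset by metis
  \<comment> \<open>The Helly property of intervals: the bag in the middle position holds one edge
    of the triangle, and the opposite vertex lies in both outer bags, hence also in the middle
    one.\<close>
  consider "i \<le> j" "j \<le> k" | "k \<le> j" "j \<le> i" | "j \<le> i" "i \<le> k" | "k \<le> i" "i \<le> j"
    | "i \<le> k" "k \<le> j" | "j \<le> k" "k \<le> i"
    by linarith
  then have "{a, b, c} \<subseteq> Bs ! i \<or> {a, b, c} \<subseteq> Bs ! j \<or> {a, b, c} \<subseteq> Bs ! k"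
    by cases (use * conv in simp_all)
  then show ?thesis using * nth_mem by metis
qed

lemma pathwidth_triangle_strip:
  assumes "even n" "n \<ge> 4"
  shows "pathwidth (with_proj (triangle_strip n)) = 2"
  unfolding pathwidth_def
proof (rule Least_equality)
  let ?G = "with_proj (triangle_strip n)"
  \<comment> \<open>One bag for each triangle; intersecting with \<open>{..<n}\<close> shortens the
    last bag to an edge.\<close>
  define bag where "bag i = {2 * i, 2 * i + 1, 2 * i + 2} \<inter> {..<n}" for i :: nat
  define Bs where "Bs = map bag [0..<n div 2]"
  have bag: "bag i \<in> set Bs" if "2 * i < n" for i using that \<open>even n\<close> by (auto simp: Bs_def)
  have mem: "x \<in> bag (x div 2)" "x < n \<Longrightarrow> bag (x div 2) \<in> set Bs" if "x < n" for x
  proof -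
    have "x = 2 * (x div 2) \<or> x = 2 * (x div 2) + 1" by arith
    then show "x \<in> bag (x div 2)" using that by (auto simp: bag_def)
  qed (auto intro!: bag)
  have "path_decomposition ?G Bs"
    unfolding path_decomposition_def
  proof (intro conjI)
    show "Bs \<noteq> []" using assms by (simp add: Bs_def)
    show "\<Union> (set Bs) = verts ?G"
    proof
      show "\<Union> (set Bs) \<subseteq> verts ?G" by (auto simp: Bs_def bag_def)
      show "verts ?G \<subseteq> \<Union> (set Bs)" using mem by auto
    qed
    have half: "\<exists>B\<in>set Bs. u \<in> B \<and> v \<in> B" if "u < v" "v < n" "v = Suc u \<or> even u \<and> v = u + 2" for u v
    proof (intro bexI conjI)
      show "u \<in> bag (u div 2)" using mem that by auto
      have "v = 2 * (u div 2) + 1 \<or> v = 2 * (u div 2) + 2" using that(3) by (auto; presburger)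
      then show "v \<in> bag (u div 2)" using that by (auto simp: bag_def)
    qed (use mem that in auto)
    show "\<forall>(u, v)\<in>arcs_ends ?G. \<exists>B\<in>set Bs. u \<in> B \<and> v \<in> B"
    proof (safe)
      fix u v assume "(u, v) \<in> arcs_ends ?G"
      then have "u < n" "v < n" "u < v \<and> (v = Suc u \<or> even u \<and> v = u + 2) \<or> v < u \<and> (u = Suc v \<or> even v \<and> u = v + 2)"
        by (auto simp: triangle_strip_def)
      then show "\<exists>B\<in>set Bs. u \<in> B \<and> v \<in> B" using half[of u v] half[of v u] by blast
    qed
    show "\<forall>i j k. i \<le> j \<and> j \<le> k \<and> k < length Bs \<longrightarrow> Bs ! i \<inter> Bs ! k \<subseteq> Bs ! j"
    proof (intro allI impI)
      fix i j k assume ijk: "i \<le> j \<and> j \<le> k \<and> k < length Bs"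
      show "Bs ! i \<inter> Bs ! k \<subseteq> Bs ! j"
      proof (cases "k \<le> Suc i")
        case True
        then have "j = i \<or> j = k" using ijk by linarith
        then show ?thesis by auto
      next
        case False
        then have "bag i \<inter> bag k = {}" by (auto simp: bag_def)
        then show ?thesis using ijk by (auto simp: Bs_def)
      qed
    qed
  qed
  moreover have "decomposition_width Bs = 2"
  proof -
    have "card (bag i) \<le> 3" for i
      unfolding bag_def by (rule order_trans[OF card_mono[of "{2 * i, 2 * i + 1, 2 * i + 2}"]]) auto
    moreover have "bag 0 = {0, 1, 2}" using assms by (auto simp: bag_def)
    then have "card (bag 0) = 3" by simp
    then have "3 \<in> card ` set Bs" using bag[of 0] assms by force
    ultimately have "Max (card ` set Bs) = 3" by (intro Max_eqI) (auto simp: Bs_def)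
    then show ?thesis by (simp add: decomposition_width_def)
  qed
  ultimately show "\<exists>Bs. path_decomposition ?G Bs \<and> decomposition_width Bs = 2" by blast
next
  let ?G = "with_proj (triangle_strip n)"
  fix w assume "\<exists>Bs. path_decomposition ?G Bs \<and> decomposition_width Bs = w"
  then obtain Bs where Bs: "path_decomposition ?G Bs" "decomposition_width Bs = w" by auto
  have "{(0, 1), (1, 2), (0, 2)} \<subseteq> arcs_ends ?G" using assms by (auto simp: triangle_strip_def)
  then obtain B where B: "B \<in> set Bs" "{0, 1, 2} \<subseteq> B" using triangle_subset_bag[OF Bs(1)] by blast
  have "B \<subseteq> {..<n}" using Bs(1) B by (auto simp: path_decomposition_def)
  then have "card {0::nat, 1, 2} \<le> card B" using B by (intro card_mono) (auto intro: finite_subset)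
  moreover have "card B \<le> Max (card ` set Bs)" using B by (intro Max_ge) auto
  ultimately show "2 \<le> w" using Bs(2) by (simp add: decomposition_width_def)
qed

section \<open>Rotations of search trees on triangle strips\<close>

lemma strip_tube_family:
  assumes "search_tree (with_proj (triangle_strip n)) t" "n > 0"
  shows "tube_family (strip_connected n) {..<n} (tubes t)"
proof -
  interpret P: pair_graph "triangle_strip n" by (rule pair_graph_triangle_strip)
  show ?thesis
    using tube_family_search_tree[OF assms(1) P.wf_digraph_axioms P.induced_subgraph_refl
        strip_strongly_connected[OF assms(2)]] by simp
qed

text \<open>A \<open>v\<close> other than \<open>y\<close> separates \<open>x\<close> from
  \<open>y\<close> and so lies between them. This keeps \<open>v\<close> in every interval that
  contains both, and thus in their dyadic block.\<close>

lemma strip_tube_lost: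
  assumes S: "tube_family (strip_connected n) {..<n} S" and T: "tube_family (strip_connected n) {..<n} T"
    and AB: "S - T = {A}" "T - S = {B}"
    and xy: "x < n" "y \<in> least_tube S x" "y \<notin> least_tube T x"
  shows "\<exists>v. swapped S T x v \<and> y \<in> least_tube T v \<and>
    (v = y \<or> even v \<and> (x < v \<and> v < y \<or> y < v \<and> v < x))"
proof -
  obtain v where v: "v < n" "swapped S T x v" "y \<in> least_tube T v" "strip_connected n (least_tube T v)"
    "y = v \<or> \<not> (\<exists>C. strip_connected n C \<and> C \<subseteq> least_tube T v - {v} \<and> x \<in> C \<and> y \<in> C)"
    using least_tube_lost[OF S T AB _ xy(2,3)] xy(1) by (metis lessThan_iff)
  have "least_tube T v \<in> T" using tube_family_props[OF T] v(1) by blast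
  then have "least_tube T v \<subseteq> {..<n}" using tube_family_props[OF T] by blast
  moreover have "x \<in> least_tube T v" "x \<noteq> v"
    using v(2) mem_least_tube[of v T] mem_least_tube[of v S] by (auto simp: swapped_def)
  ultimately have "v = y \<or> even v \<and> (x < v \<and> v < y \<or> y < v \<and> v < x)"
    using strip_separator[OF v(4) _ _ v(3), of x v] v(5) by blast
  then show ?thesis using v by blast
qed

subsection \<open>Cross swaps\<close>

text \<open>
  \<open>Q\<close> indexes pairs of leaves from the two sides of \<open>I\<close>, which form a chain at time \<open>0\<close>. A cross swap
  touches at most two pairs. If the pair \<open>t\<close> is touched by none (\<open>t \<in> C\<close>), let \<open>\<tau> t\<close> be the first time at
  which a spine vertex is above a leaf of the other side in some untouched pair up to \<open>t\<close>. The leaves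
  of these pairs still form a chain just before, so this step is a cross swap of two spine vertices
  above the last leaf \<open>b t\<close>. One of these was already above \<open>b t\<close>, hence above every later pair
  that had kept its place in the chain, and so \<open>\<tau>\<close> is strictly decreasing along the chain.
\<close>

lemma cross_swaps_lower_bound:
  fixes above swap :: "nat \<Rightarrow> 'a \<Rightarrow> 'a \<Rightarrow> bool" and spine side :: "'a \<Rightarrow> bool"
    and I :: "'a set" and a b :: "'b \<Rightarrow> 'a" and \<kappa> :: "'b \<Rightarrow> nat"
  defines "cross i u v \<equiv> u \<in> I \<and> v \<in> I \<and> side u \<noteq> side v \<and> swap i u v"
  assumes trans: "\<And>i x y z. above i x y \<Longrightarrow> above i y z \<Longrightarrow> above i x z"
    and lost: "\<And>i x y. i < m \<Longrightarrow> x \<in> I \<Longrightarrow> y \<in> I \<Longrightarrow> above i x y \<Longrightarrow> \<not> above (Suc i) x y \<Longrightarrow>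
      \<exists>v\<in>I. swap i x v \<and> above (Suc i) v y \<and> (v = y \<or> spine v)"
    and gained: "\<And>i x y. i < m \<Longrightarrow> x \<in> I \<Longrightarrow> y \<in> I \<Longrightarrow> \<not> above i x y \<Longrightarrow> above (Suc i) x y \<Longrightarrow>
      \<exists>u\<in>I. swap i u x \<and> above i u y \<and> (u = y \<or> spine u)"
    and unique: "\<And>i u v u' v'. i < m \<Longrightarrow> cross i u v \<Longrightarrow> cross i u' v' \<Longrightarrow> u = u' \<and> v = v'"
    and "finite Q" and \<kappa>: "inj_on \<kappa> Q"
    and ab: "\<And>r. r \<in> Q \<Longrightarrow> a r \<in> I \<and> b r \<in> I \<and> \<not> side (a r) \<and> side (b r)"
    and g: "\<And>r. r \<in> Q \<Longrightarrow> g (a r) = r \<and> g (b r) = r"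
    and start: "\<And>r. r \<in> Q \<Longrightarrow> above 0 (a r) (b r)"
      "\<And>r r'. r \<in> Q \<Longrightarrow> r' \<in> Q \<Longrightarrow> \<kappa> r < \<kappa> r' \<Longrightarrow> above 0 (b r) (a r')"
      "\<And>r p. r \<in> Q \<Longrightarrow> p \<in> I \<Longrightarrow> spine p \<Longrightarrow> \<not> above 0 p (a r) \<and> \<not> above 0 p (b r)"
    and final: "\<And>r. r \<in> Q \<Longrightarrow> \<not> above m (a r) (b r)"
  shows "card Q \<le> 3 * card {i. i < m \<and> (\<exists>u v. cross i u v)}"
proof -
  define N where "N = {i. i < m \<and> (\<exists>u v. cross i u v)}"
  define C where "C = {r \<in> Q. \<forall>i u v. i < m \<longrightarrow> cross i u v \<longrightarrow> {u, v} \<inter> {a r, b r} = {}}"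
  have finN: "finite N" by (simp add: N_def)
  have "card (Q - C) \<le> 2 * card N"
  proof -
    \<comment> \<open>By \<open>unique\<close>, each time in \<open>N\<close> yields a single cross
      swap, hence two vertices; \<open>g\<close> recovers the pair from either of its
      leaves.\<close>
    define W where "W = {(u, v). \<exists>i<m. cross i u v}"
    have W: "W = (\<lambda>i. SOME w. cross i (fst w) (snd w)) ` N"
    proof -
      have "(SOME w. cross i (fst w) (snd w)) = (u, v)" if "i < m" "cross i u v" for i u v
        by (rule some_equality) (use unique that in fastforce)+
      then show ?thesis unfolding W_def N_def by (auto simp: image_iff) metis+
    qed
    have finW: "finite W" and cW: "card W \<le> card N"
      unfolding W using finN by (auto intro: card_image_le)
    have "Q - C \<subseteq> g ` (fst ` W \<union> snd ` W)"
    proof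
      fix r assume r: "r \<in> Q - C"
      then obtain i u v where "i < m" "cross i u v" "{u, v} \<inter> {a r, b r} \<noteq> {}"
        unfolding C_def by blast
      then have "(u, v) \<in> W" "g u = r \<or> g v = r" using g[of r] r by (auto simp: W_def)
      then show "r \<in> g ` (fst ` W \<union> snd ` W)" by force
    qed
    then have "card (Q - C) \<le> card (g ` (fst ` W \<union> snd ` W))"
      by (rule card_mono[rotated]) (use finW in simp)
    also have "\<dots> \<le> card (fst ` W \<union> snd ` W)" using finW by (intro card_image_le) simp
    also have "\<dots> \<le> card (fst ` W) + card (snd ` W)" by (rule card_Un_le)
    also have "\<dots> \<le> 2 * card W" using card_image_le[OF finW, of fst] card_image_le[OF finW, of snd] by simp
    finally show ?thesis using cW by simp
  qed
  moreover have "card C \<le> card N"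
  proof -
    define E where "E t = (\<Union>r\<in>{r \<in> C. \<kappa> r \<le> \<kappa> t}. {a r, b r})" for t
    define V where "V i t \<longleftrightarrow> (\<exists>p x. p \<in> I \<and> spine p \<and> x \<in> E t \<and> side p \<noteq> side x \<and> above i p x)" for i t
    have CQ: "r \<in> Q" if "r \<in> C" for r using that by (simp add: C_def)
    have EI: "x \<in> I" if "x \<in> E t" for x t using that ab CQ by (auto simp: E_def)
    have clean: "\<not> cross i u v" if "i < m" "u \<in> E t \<or> v \<in> E t" for i u v t
      using that unfolding E_def C_def by blast
    \<comment> \<open>Losing the relation would swap \<open>x\<close> with some \<open>v\<close>
      above \<open>y\<close>. As \<open>x\<close> is untouched, \<open>v\<close> is on the side of
      \<open>x\<close>; so it is not \<open>y\<close> but a spine vertex above the opposite leaf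
      \<open>y\<close>, which is \<open>V\<close>.\<close>
    have kept: "above i x y"
      if i: "i \<le> m" "\<And>j. j \<le> i \<Longrightarrow> \<not> V j t" and xy: "x \<in> E t" "y \<in> E t" "side x \<noteq> side y" "above 0 x y"
      for i x y t
      using i
    proof (induction i)
      case 0
      then show ?case using xy by simp
    next
      case (Suc i)
      show ?case
      proof (rule ccontr)
        assume "\<not> above (Suc i) x y"
        moreover have "above i x y" using Suc by simp
        ultimately obtain v where v: "v \<in> I" "swap i x v" "above (Suc i) v y" "v = y \<or> spine v"
          using lost[of i x y] Suc.prems(1) EI xy by auto
        have "side v = side x"
          using clean[of i x t v] v EI[OF xy(1)] xy Suc.prems(1) by (auto simp: cross_def)
        then have "V (Suc i) t" unfolding V_def using v xy by auto
        then show False using Suc.prems(2) by auto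
      qed
    qed
    have Vm: "\<exists>i\<le>m. V i t" if "t \<in> C" for t
    proof (rule ccontr)
      assume "\<not> ?thesis"
      moreover have "a t \<in> E t" "b t \<in> E t" using that by (auto simp: E_def)
      ultimately have "above m (a t) (b t)"
        using kept[of m t "a t" "b t"] ab[OF CQ[OF that]] start(1)[OF CQ[OF that]] by auto
      then show False using final[OF CQ[OF that]] by simp
    qed
    define \<tau> where "\<tau> t = (LEAST i. V i t)" for t
    have \<tau>: "V (\<tau> t) t" "\<tau> t \<le> m" "\<And>j. j < \<tau> t \<Longrightarrow> \<not> V j t" if "t \<in> C" for t
      using Vm[OF that] LeastI[of "\<lambda>i. V i t"] Least_le[of "\<lambda>i. V i t"] not_less_Least[of _ "\<lambda>i. V i t"]
      unfolding \<tau>_def by (blast intro: order_trans)+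
    have V0: "\<not> V 0 t" if "t \<in> C" for t
      unfolding V_def E_def using start(3) CQ by auto
    have step: "\<exists>u p. \<tau> t \<noteq> 0 \<and> \<tau> t - 1 < m \<and> cross (\<tau> t - 1) u p \<and> spine u \<and> side u
        \<and> above (\<tau> t - 1) u (b t)" if t: "t \<in> C" for t
    proof -
      obtain j where j: "\<tau> t = Suc j" using V0[OF t] \<tau>(1)[OF t] by (cases "\<tau> t") auto
      have jm: "j < m" using \<tau>(2)[OF t] j by simp
      have nV: "\<not> V i t" if "i \<le> j" for i using \<tau>(3)[OF t] that j by simp
      obtain p x where p: "p \<in> I" "spine p" "x \<in> E t" "side p \<noteq> side x" "above (Suc j) p x"
        using \<tau>(1)[OF t] j unfolding V_def by auto
      have "\<not> above j p x" using nV[of j] p unfolding V_def by blast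
      then obtain u where u: "u \<in> I" "swap j u p" "above j u x" "u = x \<or> spine u"
        using gained[OF jm p(1) EI[OF p(3)]] p(5) by blast
      have "u \<noteq> x" using clean[of j x t p] u p jm by (auto simp: cross_def)
      then have sp: "spine u" using u by simp
      have su: "side u = side x" using nV[of j] u p sp unfolding V_def by blast
      \<comment> \<open>If \<open>x\<close> preceded an opposite leaf of \<open>E t\<close>, then
        \<open>u\<close> would be above that leaf too, giving \<open>V\<close> too early. So
        \<open>x\<close> ends the chain, that is, \<open>x = b t\<close>.\<close>
      have last: False if y: "y \<in> E t" "side x \<noteq> side y" "above 0 x y" for y
      proof -
        have "above j x y" using kept[of j t x y] nV jm p(3) y by simp
        then have "above j u y" using trans u(3) by blast
        then show False using nV[of j] u sp su y unfolding V_def by auto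
      qed
      obtain r where r: "r \<in> C" "\<kappa> r \<le> \<kappa> t" "x = a r \<or> x = b r" using p(3) by (auto simp: E_def)
      have "x \<noteq> a r"
        using last[of "b r"] r(1,2) ab[OF CQ[OF r(1)]] start(1)[OF CQ[OF r(1)]] by (auto simp: E_def)
      then have x: "x = b r" using r by simp
      have "\<not> \<kappa> r < \<kappa> t"
        using last[of "a t"] t x ab[OF CQ[OF r(1)]] ab[OF CQ[OF t]] start(2)[OF CQ[OF r(1)] CQ[OF t]]
        by (auto simp: E_def)
      then have "r = t" using \<kappa> CQ r(1,2) t by (auto dest: inj_onD)
      then have "x = b t" using x by simp
      then show ?thesis using u p su sp j jm ab[OF CQ[OF t]] unfolding cross_def by auto
    qed
    have dec: "\<tau> t' < \<tau> t" if t: "t \<in> C" "t' \<in> C" "\<kappa> t < \<kappa> t'" for t t'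
    proof -
      obtain u p where u: "\<tau> t \<noteq> 0" "\<tau> t - 1 < m" "cross (\<tau> t - 1) u p" "spine u" "side u"
        "above (\<tau> t - 1) u (b t)" using step[OF t(1)] by auto
      have E: "b t \<in> E t'" "a t' \<in> E t'" using t by (auto simp: E_def)
      have "\<exists>j\<le>\<tau> t - 1. V j t'"
      proof (rule ccontr)
        assume n: "\<not> ?thesis"
        then have "above (\<tau> t - 1) (b t) (a t')"
          using kept[of "\<tau> t - 1" t' "b t" "a t'"] u(2) E ab[OF CQ[OF t(1)]] ab[OF CQ[OF t(2)]]
            start(2)[OF CQ[OF t(1)] CQ[OF t(2)] t(3)] by auto
        then have "above (\<tau> t - 1) u (a t')" using trans u(6) by blast
        then have "V (\<tau> t - 1) t'" unfolding V_def
          using u E ab[OF CQ[OF t(2)]] unfolding cross_def by blast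
        then show False using n by auto
      qed
      then obtain j where "j \<le> \<tau> t - 1" "V j t'" by auto
      then have "\<tau> t' \<le> \<tau> t - 1" using \<tau>(3)[OF t(2)] by (meson le_trans not_le)
      then show ?thesis using u(1) by simp
    qed
    \<comment> \<open>The cross swap happens in the step from \<open>\<tau> t - 1\<close> to
      \<open>\<tau> t\<close>; \<open>step\<close> gives \<open>\<tau> t \<noteq> 0\<close>, so the
      subtraction never truncates.\<close>
    have "inj_on (\<lambda>t. \<tau> t - 1) C"
    proof (rule inj_onI, rule ccontr)
      fix t t' assume t: "t \<in> C" "t' \<in> C" "\<tau> t - 1 = \<tau> t' - 1" "t \<noteq> t'"
      have "\<tau> t = \<tau> t'" using step[OF t(1)] step[OF t(2)] t(3) by auto
      moreover have "\<kappa> t \<noteq> \<kappa> t'" using t \<kappa> CQ by (auto dest: inj_onD)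
      ultimately show False using dec[OF t(1,2)] dec[OF t(2,1)] by linarith
    qed
    moreover have "(\<lambda>t. \<tau> t - 1) ` C \<subseteq> N" using step unfolding N_def by blast
    ultimately show ?thesis using finN by (metis card_image card_mono)
  qed
  moreover have "card Q \<le> card (Q - C) + card C"
    using \<open>finite Q\<close> card_Un_le[of "Q - C" C] by (simp add: C_def Un_absorb2 Un_commute)
  ultimately show ?thesis unfolding N_def by linarith
qed

subsection \<open>Bit reversal and dyadic levels\<close>

text \<open>The level is the position of the highest binary digit in which \<open>x\<close> and
  \<open>y\<close> differ.\<close>

lemma div_pow2_level_unique:
  fixes x y :: nat
  assumes "x div 2 ^ Suc e = y div 2 ^ Suc e" "x div 2 ^ e \<noteq> y div 2 ^ e"
    and "x div 2 ^ Suc e' = y div 2 ^ Suc e'" "x div 2 ^ e' \<noteq> y div 2 ^ e'"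
  shows "e = e'"
proof -
  have "x div 2 ^ f = y div 2 ^ f" if "x div 2 ^ Suc e = y div 2 ^ Suc e" "e < f" for e f
  proof -
    have "(2::nat) ^ f = 2 ^ Suc e * 2 ^ (f - Suc e)" using that by (metis Suc_leI le_add_diff_inverse power_add)
    then show ?thesis using that by (simp only: div_mult2_eq)
  qed
  then show ?thesis using assms by (metis linorder_neqE_nat)
qed

fun bit_rev :: "nat \<Rightarrow> nat \<Rightarrow> nat" where
  "bit_rev 0 x = 0"
| "bit_rev (Suc k) x = (x mod 2) * 2 ^ k + bit_rev k (x div 2)"

lemma bit_rev_less: "bit_rev k x < 2 ^ k"
proof (induction k arbitrary: x)
  case (Suc k)
  have "x mod 2 = 0 \<or> x mod 2 = 1" by auto
  then show ?case using Suc[of "x div 2"] by auto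
qed simp

text \<open>The low digits, the offset inside a half block, become the leading ones. The order is
  decided by the offset first and by the half only among equal offsets, hence the
  alternation.\<close>

lemma bit_rev_append:
  "r < 2 ^ e \<Longrightarrow> bit_rev (e + m) (s * 2 ^ e + r) = bit_rev e r * 2 ^ m + bit_rev m s"
proof (induction e arbitrary: r)
  case (Suc e)
  have "(s * 2 ^ Suc e + r) mod 2 = r mod 2" "(s * 2 ^ Suc e + r) div 2 = s * 2 ^ e + r div 2"
    by (simp_all add: mod_add_eq[symmetric] algebra_simps)
  moreover have "r div 2 < 2 ^ e" using Suc by auto
  ultimately show ?case using Suc.IH[of "r div 2"] by (simp add: algebra_simps power_add)
qed simp

lemma bit_rev_inj: "inj_on (bit_rev k) {..<2 ^ k}"
proof (induction k)
  case (Suc k)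
  show ?case
  proof (rule inj_onI)
    fix x y assume xy: "x \<in> {..<2 ^ Suc k}" "y \<in> {..<2 ^ Suc k}" "bit_rev (Suc k) x = bit_rev (Suc k) y"
    have l: "bit_rev k (x div 2) < 2 ^ k" "bit_rev k (y div 2) < 2 ^ k" using bit_rev_less by auto
    have "x mod 2 = y mod 2"
      using arg_cong[OF xy(3), of "\<lambda>z. z div 2 ^ k"] l by simp
    moreover have "bit_rev k (x div 2) = bit_rev k (y div 2)"
      using xy(3) calculation by simp
    then have "x div 2 = y div 2" using Suc xy by (auto dest!: inj_onD)
    ultimately show "x = y" by (metis mult_div_mod_eq)
  qed
qed (auto simp: inj_on_def)

subsection \<open>The lower bound\<close>

text \<open>
  Both trees are chains, from the least rank at the root, with the odd vertices above the even ones.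
  Bit reversal makes the odd vertices of every dyadic block alternate between its two halves; in the
  final tree those of the right half precede those of the left half.
\<close>

definition start_rank :: "nat \<Rightarrow> nat \<Rightarrow> nat" where
  "start_rank k x = (if odd x then bit_rev k x else 2 ^ k + x)"

definition final_rank :: "nat \<Rightarrow> nat \<Rightarrow> nat" where
  "final_rank k x = (if odd x then 2 ^ k - x else 2 ^ k + x)"

text \<open>The rank conditions put into each upper set, with any vertex, all larger even vertices;
  by \<open>strip_connected_iff\<close> upper sets are then connected.\<close>

lemma strip_search_tree_chain:
  fixes \<kappa> :: "nat \<Rightarrow> nat"
  assumes "n > 0" "inj_on \<kappa> {..<n}" "\<And>x y. x < n \<Longrightarrow> y < n \<Longrightarrow> odd x \<Longrightarrow> even y \<Longrightarrow> \<kappa> x < \<kappa> y"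
    and "\<And>x y. even x \<Longrightarrow> even y \<Longrightarrow> x < y \<Longrightarrow> \<kappa> x < \<kappa> y"
  shows "\<exists>t. search_tree (with_proj (triangle_strip n)) t \<and>
    (\<forall>x<n. least_tube (tubes t) x = {y \<in> {..<n}. \<kappa> x \<le> \<kappa> y})"
proof -
  interpret P: pair_graph "triangle_strip n" by (rule pair_graph_triangle_strip)
  have "strip_connected n {y \<in> {..<n}. \<kappa> x \<le> \<kappa> y}" if "x < n" for x
  proof (subst strip_connected_iff)
    have "\<kappa> x \<le> \<kappa> z" if "\<kappa> x \<le> \<kappa> u" "u < z" "even z" "z < n" for u z
      using assms(3)[of u z] assms(4)[of u z] that by (cases "odd u") auto
    then show "{y \<in> {..<n}. \<kappa> x \<le> \<kappa> y} \<noteq> {} \<and> (\<forall>u\<in>{y \<in> {..<n}. \<kappa> x \<le> \<kappa> y}. \<forall>v\<in>{y \<in> {..<n}. \<kappa> x \<le> \<kappa> y}.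
      \<forall>z. even z \<and> u < z \<and> z < v \<longrightarrow> z \<in> {y \<in> {..<n}. \<kappa> x \<le> \<kappa> y})"
      using that by auto
  qed auto
  then obtain t where "search_tree (with_proj (triangle_strip n) \<restriction> {..<n}) t"
    "tubes t = (\<lambda>x. {y \<in> {..<n}. \<kappa> x \<le> \<kappa> y}) ` {..<n}"
    using search_tree_chain[OF P.wf_digraph_axioms _ _ assms(2)] assms(1) by auto
  moreover have "with_proj (triangle_strip n) \<restriction> {..<n} = with_proj (triangle_strip n)"
    using P.induce_eq_iff_induced[OF P.induced_subgraph_refl] by simp
  ultimately show ?thesis using least_tube_chain[of _ "{..<n}" \<kappa>] by auto
qed

lemma start_tree:
  "\<exists>t. search_tree (with_proj (triangle_strip (2 ^ k))) t \<and>
    (\<forall>x<2 ^ k. least_tube (tubes t) x = {y \<in> {..<2 ^ k}. start_rank k x \<le> start_rank k y})"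
proof (rule strip_search_tree_chain)
  show "inj_on (start_rank k) {..<2 ^ k}"
  proof (rule inj_onI)
    fix x y assume "x \<in> {..<2 ^ k}" "y \<in> {..<2 ^ k}" "start_rank k x = start_rank k y"
    then show "x = y" using bit_rev_less[of k x] bit_rev_less[of k y] inj_onD[OF bit_rev_inj[of k], of x y]
      by (auto simp: start_rank_def split: if_splits)
  qed
  show "start_rank k x < start_rank k y" if "odd x" "even y" for x y
    using bit_rev_less[of k x] that by (simp add: start_rank_def)
qed (auto simp: start_rank_def)

lemma final_tree:
  "\<exists>t. search_tree (with_proj (triangle_strip (2 ^ k))) t \<and>
    (\<forall>x<2 ^ k. least_tube (tubes t) x = {y \<in> {..<2 ^ k}. final_rank k x \<le> final_rank k y})"
proof (rule strip_search_tree_chain)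
  show "inj_on (final_rank k) {..<2 ^ k}"
    by (rule inj_onI) (auto simp: final_rank_def odd_pos split: if_splits)
  show "final_rank k x < final_rank k y" if "odd x" "even y" for x y
    using that odd_pos[of x] by (auto simp: final_rank_def intro!: trans_less_add1 diff_less)
qed (auto simp: final_rank_def)

text \<open>An instance of \<open>cross_swaps_lower_bound\<close>: spine vertices are the even ones,
  sides are the halves of the block, and the pair \<open>r\<close> consists of the vertices at the
  odd offset \<open>r\<close> in the two halves.\<close>

lemma rotations_lower_bound_block:
  fixes f :: "nat \<Rightarrow> nat rtree"
  assumes n: "n = 2 ^ k" and e: "0 < e" "e < k" and q: "q < 2 ^ (k - Suc e)"
    and tree: "\<And>i. i \<le> m \<Longrightarrow> search_tree (with_proj (triangle_strip n)) (f i)"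
    and rot: "\<And>i. i < m \<Longrightarrow> rotation (f i) (f (Suc i))"
    and S: "\<And>x. x < n \<Longrightarrow> least_tube (tubes (f 0)) x = {y \<in> {..<n}. start_rank k x \<le> start_rank k y}"
    and T: "\<And>x. x < n \<Longrightarrow> least_tube (tubes (f m)) x = {y \<in> {..<n}. final_rank k x \<le> final_rank k y}"
  shows "2 ^ (e - 1) \<le> 3 * card {i. i < m \<and> (\<exists>u v. u div 2 ^ Suc e = q \<and> v div 2 ^ Suc e = q \<and>
    u div 2 ^ e \<noteq> v div 2 ^ e \<and> swapped (tubes (f i)) (tubes (f (Suc i))) u v)}"
    (is "_ \<le> 3 * card ?N")
proof -
  define I where "I = {x. x div 2 ^ Suc e = q}"
  define side where "side x = odd (x div 2 ^ e)" for x :: nat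
  define above where "above i x y \<longleftrightarrow> y \<in> least_tube (tubes (f i)) x" for i x y
  define swap where "swap i u v \<longleftrightarrow> swapped (tubes (f i)) (tubes (f (Suc i))) u v" for i u v
  define Q where "Q = {r::nat. r < 2 ^ e \<and> odd r}"
  define a where "a r = 2 * q * 2 ^ e + r" for r
  define b where "b r = (2 * q + 1) * 2 ^ e + r" for r
  have kpos: "n > 0" using n by simp
  have fam: "tube_family (strip_connected n) {..<n} (tubes (f i))" if "i \<le> m" for i
    using strip_tube_family[OF tree[OF that] kpos] .
  have rotE: "\<exists>A B. tubes (f i) - tubes (f (Suc i)) = {A} \<and> tubes (f (Suc i)) - tubes (f i) = {B}"
    if "i < m" for i
    using tube_families_rotation[OF _ fam[of i] fam[of "Suc i"]] rot[OF that] that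
    unfolding rotation_def by (metis Suc_leI finite_lessThan less_imp_le)
  have In: "x < n" if "x \<in> I" for x
  proof -
    have "x div 2 ^ Suc e < 2 ^ (k - Suc e)" using that q by (simp add: I_def)
    then have "x < 2 ^ (k - Suc e) * 2 ^ Suc e" by (subst (asm) div_less_iff_less_mult) auto
    then show ?thesis using n e by (simp only: flip: power_add) simp
  qed
  \<comment> \<open>Blocks are intervals, so separating vertices supplied by
    \<open>strip_tube_lost\<close> stay inside.\<close>
  have Iconv: "v \<in> I" if "x \<in> I" "y \<in> I" "x < v \<and> v < y \<or> y < v \<and> v < x" for v x y
  proof -
    have "x div 2 ^ Suc e = q" "y div 2 ^ Suc e = q" using that by (simp_all add: I_def)
    moreover have "min x y div 2 ^ Suc e \<le> v div 2 ^ Suc e" "v div 2 ^ Suc e \<le> max x y div 2 ^ Suc e"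
      using that by (intro div_le_mono; auto)+
    ultimately have "v div 2 ^ Suc e = q" by (auto simp: min_def max_def split: if_splits)
    then show ?thesis by (simp add: I_def)
  qed
  have side_div: "side u \<noteq> side v \<longleftrightarrow> u div 2 ^ e \<noteq> v div 2 ^ e" if "u \<in> I" "v \<in> I" for u v
  proof -
    have "u div 2 ^ e div 2 = v div 2 ^ e div 2" using that by (simp add: I_def div_mult2_eq[symmetric] mult.commute)
    then show ?thesis unfolding side_def by (metis dvd_div_mult_self odd_two_times_div_two_succ mult.commute)
  qed
  have ab: "a r \<in> I" "b r \<in> I" "\<not> side (a r)" "side (b r)" "a r mod 2 ^ e = r" "b r mod 2 ^ e = r" "odd (a r)" "odd (b r)"
    if "r \<in> Q" for r
  proof -
    have r: "r < 2 ^ e" "odd r" using that by (auto simp: Q_def)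
    have d: "a r div 2 ^ e = 2 * q" "b r div 2 ^ e = 2 * q + 1"
      using r div_mult_self3[of "2 ^ e" "2 * q" r] div_mult_self3[of "2 ^ e" "2 * q + 1" r]
      unfolding a_def b_def by simp_all
    have "x div 2 ^ Suc e = x div 2 ^ e div 2" for x :: nat
      unfolding power_Suc2 div_mult2_eq ..
    then show "a r \<in> I" "b r \<in> I" using d by (simp_all add: I_def)
    show "\<not> side (a r)" "side (b r)" using d by (simp_all add: side_def)
    show "a r mod 2 ^ e = r" "b r mod 2 ^ e = r"
      using r mod_mult_self3[of "2 * q" "2 ^ e" r] mod_mult_self3[of "2 * q + 1" "2 ^ e" r]
      unfolding a_def b_def by simp_all
    show "odd (a r)" "odd (b r)" using r e by (simp_all add: a_def b_def)
  qed
  define l where "l = k - e"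
  have l: "k = e + l" "0 < l" using e by (auto simp: l_def)
  have rev_a: "bit_rev k (a r) = bit_rev e r * 2 ^ l + bit_rev l (2 * q)"
    and rev_b: "bit_rev k (b r) = bit_rev e r * 2 ^ l + bit_rev l (2 * q + 1)" if "r \<in> Q" for r
    using that bit_rev_append[of r e l "2 * q"] bit_rev_append[of r e l "2 * q + 1"]
    unfolding Q_def a_def b_def l(1) by simp_all
  have "card Q \<le> 3 * card {i. i < m \<and> (\<exists>u v. u \<in> I \<and> v \<in> I \<and> side u \<noteq> side v \<and> swap i u v)}"
  proof (rule cross_swaps_lower_bound[where above = above and spine = even and a = a and b = b
        and \<kappa> = "bit_rev e" and g = "\<lambda>x. x mod 2 ^ e"])
    show "above i x z" if "above i x y" "above i y z" for i x y z
      using that least_tube_trans unfolding above_def by metis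
    show "\<exists>v\<in>I. swap i x v \<and> above (Suc i) v y \<and> (v = y \<or> even v)"
      if "i < m" "x \<in> I" "y \<in> I" "above i x y" "\<not> above (Suc i) x y" for i x y
    proof -
      from rotE[OF that(1)] obtain A B
        where "tubes (f i) - tubes (f (Suc i)) = {A}" "tubes (f (Suc i)) - tubes (f i) = {B}" by auto
      from strip_tube_lost[OF fam fam this In[OF that(2)]] that Iconv[OF that(2,3)]
      show ?thesis unfolding above_def swap_def by (metis Suc_leI less_imp_le)
    qed
    show "\<exists>u\<in>I. swap i u x \<and> above i u y \<and> (u = y \<or> even u)"
      if "i < m" "x \<in> I" "y \<in> I" "\<not> above i x y" "above (Suc i) x y" for i x y
    proof -
      from rotE[OF that(1)] obtain A B
        where "tubes (f i) - tubes (f (Suc i)) = {A}" "tubes (f (Suc i)) - tubes (f i) = {B}" by auto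
      from strip_tube_lost[OF fam fam this(2,1) In[OF that(2)]] that Iconv[OF that(2,3)]
      show ?thesis unfolding above_def swap_def by (metis Suc_leI less_imp_le swapped_commute)
    qed
    show "u = u' \<and> v = v'"
      if "i < m" "u \<in> I \<and> v \<in> I \<and> side u \<noteq> side v \<and> swap i u v"
        "u' \<in> I \<and> v' \<in> I \<and> side u' \<noteq> side v' \<and> swap i u' v'" for i u v u' v'
    proof -
      from rotE[OF that(1)] obtain A B
        where "tubes (f i) - tubes (f (Suc i)) = {A}" "tubes (f (Suc i)) - tubes (f i) = {B}" by auto
      from swapped_unique[OF fam fam this, of u v u' v'] that In
      show ?thesis unfolding swap_def by simp
    qed
    show "finite Q" by (simp add: Q_def)
    show "inj_on (bit_rev e) Q" using bit_rev_inj by (rule inj_on_subset) (auto simp: Q_def)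
    show "a r \<in> I \<and> b r \<in> I \<and> \<not> side (a r) \<and> side (b r)" if "r \<in> Q" for r using ab that by blast
    show "a r mod 2 ^ e = r \<and> b r mod 2 ^ e = r" if "r \<in> Q" for r using ab that by blast
    show "above 0 (a r) (b r)" if "r \<in> Q" for r
    proof -
      \<comment> \<open>The two numbers differ only in the last digit, which reversal makes the
        leading one: at equal offset the left half comes first.\<close>
      obtain l' where "l = Suc l'" using l(2) by (cases l) auto
      then have "bit_rev l (2 * q) \<le> bit_rev l (2 * q + 1)" by simp
      then show ?thesis
        unfolding above_def S[OF In[OF ab(1)[OF that]]] using ab[OF that] In rev_a rev_b that
        by (simp add: start_rank_def)
    qed
    show "above 0 (b r) (a r')" if "r \<in> Q" "r' \<in> Q" "bit_rev e r < bit_rev e r'" for r r'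
    proof -
      have "bit_rev e r * 2 ^ l + 2 ^ l \<le> bit_rev e r' * 2 ^ l"
        using mult_le_mono1[of "Suc (bit_rev e r)" "bit_rev e r'" "2 ^ l"] that(3) by simp
      then have "bit_rev k (b r) \<le> bit_rev k (a r')"
        using rev_a[OF that(2)] rev_b[OF that(1)] bit_rev_less[of l "2 * q + 1"] by simp
      then show ?thesis
        unfolding above_def S[OF In[OF ab(2)[OF that(1)]]] using ab[OF that(1)] ab[OF that(2)] In
        by (simp add: start_rank_def)
    qed
    show "\<not> above 0 p (a r) \<and> \<not> above 0 p (b r)" if "r \<in> Q" "p \<in> I" "even p" for r p
      unfolding above_def S[OF In[OF that(2)]]
      using ab[OF that(1)] that(3) bit_rev_less[of k "a r"] bit_rev_less[of k "b r"]
      by (simp add: start_rank_def)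
    show "\<not> above m (a r) (b r)" if "r \<in> Q" for r
    proof -
      have "a r < b r" "b r < n" using ab[OF that] In by (simp_all add: a_def b_def)
      then show ?thesis
        unfolding above_def T[OF In[OF ab(1)[OF that]]] using ab[OF that] n by (simp add: final_rank_def)
    qed
  qed
  moreover have "card Q = 2 ^ (e - 1)"
  proof -
    obtain e' where e': "e = Suc e'" using e by (cases e) auto
    have "Q = (\<lambda>j. 2 * j + 1) ` {..<2 ^ e'}"
    proof
      show "Q \<subseteq> (\<lambda>j. 2 * j + 1) ` {..<2 ^ e'}" unfolding Q_def e' by (auto elim!: oddE)
      show "(\<lambda>j. 2 * j + 1) ` {..<2 ^ e'} \<subseteq> Q" unfolding Q_def e' by auto
    qed
    then show ?thesis by (simp add: card_image inj_on_def e')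
  qed
  moreover have "{i. i < m \<and> (\<exists>u v. u \<in> I \<and> v \<in> I \<and> side u \<noteq> side v \<and> swap i u v)} = ?N"
    using side_div unfolding swap_def I_def by blast
  ultimately show ?thesis by simp
qed

text \<open>A rotation swaps one pair of vertices, and the pair determines its level and block; so
  the times counted for different blocks are disjoint and the block bounds add up.\<close>

lemma rotations_lower_bound:
  fixes f :: "nat \<Rightarrow> nat rtree"
  assumes n: "n = 2 ^ k" and k: "k \<ge> 2"
    and tree: "\<And>i. i \<le> m \<Longrightarrow> search_tree (with_proj (triangle_strip n)) (f i)"
    and rot: "\<And>i. i < m \<Longrightarrow> rotation (f i) (f (Suc i))"
    and S: "\<And>x. x < n \<Longrightarrow> least_tube (tubes (f 0)) x = {y \<in> {..<n}. start_rank k x \<le> start_rank k y}"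
    and T: "\<And>x. x < n \<Longrightarrow> least_tube (tubes (f m)) x = {y \<in> {..<n}. final_rank k x \<le> final_rank k y}"
  shows "(k - 1) * 2 ^ (k - 2) \<le> 3 * m"
proof -
  \<comment> \<open>Levels start at 1, since a block of two vertices contains only one odd vertex
    and so no pair.\<close>
  define P where "P = (SIGMA e:{1..<k}. {..<(2::nat) ^ (k - Suc e)})"
  define N where "N p = {i. i < m \<and> (\<exists>u v. u div 2 ^ Suc (fst p) = snd p \<and> v div 2 ^ Suc (fst p) = snd p \<and>
    u div 2 ^ fst p \<noteq> v div 2 ^ fst p \<and> swapped (tubes (f i)) (tubes (f (Suc i))) u v)}" for p
  have kpos: "n > 0" using n by simp
  have fam: "tube_family (strip_connected n) {..<n} (tubes (f i))" if "i \<le> m" for i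
    using strip_tube_family[OF tree[OF that] kpos] .
  have finP: "finite P" by (auto simp: P_def)
  have less_n: "x < n" if "(e, x div 2 ^ Suc e) \<in> P" for e x
  proof -
    have e: "e < k" "x div 2 ^ Suc e < 2 ^ (k - Suc e)" using that by (auto simp: P_def)
    then have "x < 2 ^ (k - Suc e) * 2 ^ Suc e" by (subst (asm) div_less_iff_less_mult) auto
    then show ?thesis using n e(1) by (simp only: flip: power_add) simp
  qed
  have disj: "N p \<inter> N p' = {}" if p: "p \<in> P" "p' \<in> P" "p \<noteq> p'" for p p'
  proof (rule ccontr)
    assume "N p \<inter> N p' \<noteq> {}"
    then obtain i u v u' v' where i: "i < m"
      and u: "u div 2 ^ Suc (fst p) = snd p" "v div 2 ^ Suc (fst p) = snd p" "u div 2 ^ fst p \<noteq> v div 2 ^ fst p"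
        "swapped (tubes (f i)) (tubes (f (Suc i))) u v"
      and u': "u' div 2 ^ Suc (fst p') = snd p'" "v' div 2 ^ Suc (fst p') = snd p'" "u' div 2 ^ fst p' \<noteq> v' div 2 ^ fst p'"
        "swapped (tubes (f i)) (tubes (f (Suc i))) u' v'"
      unfolding N_def by blast
    have "u < n" "v < n" "u' < n" "v' < n" using less_n p u u' by (metis prod.collapse)+
    moreover obtain A B where "tubes (f i) - tubes (f (Suc i)) = {A}" "tubes (f (Suc i)) - tubes (f i) = {B}"
      using tube_families_rotation[OF _ fam[of i] fam[of "Suc i"]] rot[OF i] i
      unfolding rotation_def by (metis Suc_leI finite_lessThan less_imp_le)
    ultimately have "u = u' \<and> v = v'"
      using swapped_unique[OF fam[of i] fam[of "Suc i"], of A B u v u' v'] u u' i by simp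
    then have "fst p = fst p'" using div_pow2_level_unique[of u "fst p" v "fst p'"] u u' by metis
    then show False using p(3) u u' \<open>u = u' \<and> v = v'\<close> by (metis prod.expand)
  qed
  have "(k - 1) * 2 ^ (k - 2) = (\<Sum>e\<in>{1..<k}. 2 ^ (k - 2))" by simp
  also have "\<dots> = (\<Sum>e\<in>{1..<k}. \<Sum>q<(2::nat) ^ (k - Suc e). 2 ^ (e - 1))"
  proof (rule sum.cong)
    fix e assume "e \<in> {1..<k}"
    then have "k - 2 = (k - Suc e) + (e - 1)" by auto
    then show "2 ^ (k - 2) = (\<Sum>q<(2::nat) ^ (k - Suc e). (2::nat) ^ (e - 1))" by (simp add: power_add)
  qed simp
  also have "\<dots> = (\<Sum>p\<in>P. 2 ^ (fst p - 1))" unfolding P_def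
    by (subst sum.Sigma) (simp_all add: split_beta)
  also have "\<dots> \<le> (\<Sum>p\<in>P. 3 * card (N p))"
  proof (rule sum_mono)
    fix p assume "p \<in> P"
    then show "2 ^ (fst p - 1) \<le> 3 * card (N p)"
      unfolding N_def P_def
      using rotations_lower_bound_block[OF n _ _ _ tree rot S T, of "fst p" "snd p"] by auto
  qed
  also have "\<dots> = 3 * card (\<Union>p\<in>P. N p)"
    using disj finP by (subst card_UN_disjoint) (auto simp: N_def sum_distrib_left)
  also have "card (\<Union>p\<in>P. N p) \<le> card {..<m}" by (intro card_mono) (auto simp: N_def)
  finally show ?thesis by simp
qed

section \<open>From rotation sequences to the diameter\<close>

lemma awalk_relpow:
  assumes "pre_digraph.awalk (with_proj G) u p v"
  shows "(u, v) \<in> parcs G ^^ length p"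
proof -
  interpret pair_pre_digraph G .
  have "set p \<subseteq> parcs G \<Longrightarrow> pcas u p v \<Longrightarrow> (u, v) \<in> parcs G ^^ length p"
  proof (induction p arbitrary: u)
    case (Cons e p)
    then show ?case using relpow_Suc_I2[of u "snd e" "parcs G" v "length p"] by auto
  qed simp
  then show ?thesis using assms by (simp add: awalk_def)
qed

lemma associahedron_diameter_triangle_strip:
  assumes n: "n = 2 ^ k" and k: "k \<ge> 2"
  shows "ereal (real n * real k / 24) \<le> associahedron_diameter (with_proj (triangle_strip n))"
proof -
  let ?G = "with_proj (triangle_strip n)" and ?R = "with_proj (rotation_graph (with_proj (triangle_strip n)))"
  interpret R: wf_digraph ?R by (simp add: wf_digraph_wp_iff pair_wf_digraph_rotation_graph)
  obtain S where S: "search_tree ?G S"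
    "\<forall>x<n. least_tube (tubes S) x = {y \<in> {..<n}. start_rank k x \<le> start_rank k y}"
    using start_tree n by blast
  obtain T where T: "search_tree ?G T"
    "\<forall>x<n. least_tube (tubes T) x = {y \<in> {..<n}. final_rank k x \<le> final_rank k y}"
    using final_tree n by blast
  have "real n * real k / 24 \<le> R.awalk_cost (\<lambda>_. 1) p" if p: "R.awalk S p T" for p
  proof -
    obtain f where f: "f 0 = S" "f (length p) = T" "\<And>i. i < length p \<Longrightarrow> (f i, f (Suc i)) \<in> parcs (rotation_graph ?G)"
      using awalk_relpow[OF p] unfolding relpow_fun_conv by blast
    have rot: "search_tree ?G (f i)" "rotation (f i) (f (Suc i))" if "i < length p" for i
      using f(3)[OF that] by (auto simp: rotation_graph_def)
    have tree: "search_tree ?G (f i)" if "i \<le> length p" for i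
      using that rot(1) f(2) T(1) by (cases "i = length p") auto
    have le: "(k - 1) * 2 ^ (k - 2) \<le> 3 * length p"
      using rotations_lower_bound[where f = f and m = "length p", OF n k tree rot(2)] S(2) T(2) f(1,2) by blast
    have "(2::nat) ^ k = 2\<^sup>2 * 2 ^ (k - 2)" using k by (metis le_add_diff_inverse power_add)
    then have "n = 4 * 2 ^ (k - 2)" using n by simp
    \<comment> \<open>The constant is 24 = 3 * 4 * 2: the factor 3 of the block bound,
      \<open>n = 4 * 2 ^ (k - 2)\<close>, and \<open>k \<le> 2 * (k - 1)\<close>.\<close>
    moreover have "4 * 2 ^ (k - 2) * k \<le> 4 * 2 ^ (k - 2) * (2 * (k - 1))"
      using k by (intro mult_le_mono) auto
    ultimately have "n * k \<le> 8 * ((k - 1) * 2 ^ (k - 2))" by (simp add: mult.commute mult.left_commute)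
    then have "n * k \<le> 24 * length p" using le by linarith
    then have "real n * real k \<le> 24 * real (length p)" by (metis of_nat_le_iff of_nat_mult of_nat_numeral)
    moreover have "R.awalk_cost (\<lambda>_. 1) p = real (length p)"
      by (simp add: R.awalk_cost_def sum_list_triv)
    ultimately show ?thesis by simp
  qed
  \<comment> \<open>The distance is an infimum over walks, so bounding every walk suffices.\<close>
  then have "ereal (real n * real k / 24) \<le> R.\<mu> (\<lambda>_. 1) S T"
    unfolding R.\<mu>_def by (intro INF_greatest) auto
  also have "\<dots> \<le> graph_diameter ?R"
    unfolding graph_diameter_def using S(1) T(1)
    by (intro SUP_upper2[of S] SUP_upper2[of T]) (auto simp: rotation_graph_def)
  finally show ?thesis by (simp add: associahedron_diameter_def)
qed

theorem theorem20:
  shows "\<exists>c::real. c > 0 \<and>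
    (\<forall>n::nat. n \<ge> 4 \<and> (\<exists>k::nat. n = 2 ^ k) \<longrightarrow>
      (\<exists>G :: nat pair_pre_digraph.
         pair_graph G \<and>
         Digraph_Component.connected (with_proj G) \<and>
         card (pverts G) = n \<and>
         pathwidth (with_proj G) = 2 \<and>
         associahedron_diameter (with_proj G) \<ge> ereal (c * real n * log 2 (real n))))"
proof (intro exI[of _ "1 / 24"] conjI allI impI)
  fix n :: nat assume n: "n \<ge> 4 \<and> (\<exists>k. n = 2 ^ k)"
  then obtain k where k: "n = 2 ^ k" by blast
  have "k \<ge> 2"
  proof (rule ccontr)
    assume "\<not> k \<ge> 2"
    then have "k = 0 \<or> k = 1" by linarith
    then show False using n k by auto
  qed
  have "log 2 (real n) = real k" using k by (simp add: log_nat_power)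
  then have "ereal (1 / 24 * real n * log 2 (real n)) \<le> associahedron_diameter (with_proj (triangle_strip n))"
    using associahedron_diameter_triangle_strip[OF k \<open>k \<ge> 2\<close>] by simp
  moreover have "even n" using k \<open>k \<ge> 2\<close> by simp
  ultimately show "\<exists>G :: nat pair_pre_digraph. pair_graph G \<and> Digraph_Component.connected (with_proj G) \<and>
      card (pverts G) = n \<and> pathwidth (with_proj G) = 2 \<and>
      associahedron_diameter (with_proj G) \<ge> ereal (1 / 24 * real n * log 2 (real n))"
    using pair_graph_triangle_strip connected_triangle_strip pathwidth_triangle_strip n
    by (intro exI[of _ "triangle_strip n"]) auto
qed simp

end
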